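(* Fix $\beta^{(0)}\in\mathscr{A}^*$. For $\rho\in[0,1)$ define recursively, for $n\ge1$ (starting from $\beta_\rho^{(0)}=\beta^{(0)}$), $$v_\rho^{(n)}:=v^{\beta_\rho^{(n-1)}},\qquad \alpha_\rho^{(n)}:=\alpha^*(\beta_\rho^{(n-1)}),\qquad \beta_\rho^{(n)}:=\rho\,\beta_\rho^{(n-1)}+(1-\rho)\,\alpha_\rho^{(n)},$$ and let $v$ be the unique classical solution of the $N$-NLL equation. For $\rho\in(0,1)$ there are $\gamma_\rho\in(0,1)$ and $c_\rho>0$ satisfying $$\sup_{t\in[0,T]}|v_\rho^{(n)}(t)-v(t)|_2\le c_\rho\,\gamma_\rho^{\,n},\qquad n\ge1,$$ where moreover $\rho\mapsto\gamma_\rho$ is non-decreasing on $(0,1)$ and $\lim_{\rho\downarrow0}\gamma_\rho=0$. Additionally, for every $\eta>0$ there exists $\hat c_\eta>0$ such that $$\sup_{t\in[0,T]}|v_0^{(n)}(t)-v(t)|_2\le\hat c_\eta\,\eta^n,\qquad n\ge1 .$$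
   Context: Setting. $N,d$ are positive integers, $T>0$, $\mathcal{X}=\{1,\dots,d\}$, $\Sigma^{d-1}_N=\{\mu\in\{0,1/N,2/N,\dots,1\}^d:\mu_1+\dots+\mu_d=1\}$, $\mathscr{X}=\mathcal{X}\times\Sigma^{d-1}_N$, $\mathbb{R}_+=[0,\infty)$. For $\mu\in\Sigma_N^{d-1}$ put $n^\mu_x=N\mu_x$; $e_x$ is the $x$-th unit vector of $\mathbb{R}^d$ and $e_{x,z}=\frac1N(e_x-e_z)$. Vectors in $\mathbb{R}^{d-1}$ attached to a state $x$ are indexed by $y\in\mathcal{X}\setminus\{x\}$ (in increasing order); e.g. $\alpha_y(t,x,\mu)$, $y\ne x$, is the rate of moving from $x$ to $y$. $|\cdot|_2$ is the Euclidean norm on $\mathbb{R}^k$; for $\psi:[0,T]\times\mathscr{X}\to\mathbb{R}^k$, $\psi(t)$ denotes the function $\psi(t,\cdot,\cdot)$ and $|\psi(t)|_2^2=\sum_{(x,\mu)\in\mathscr{X}}|\psi(t,x,\mu)|_2^2$. Data. Fixed functions $\lambda^0,\lambda^1:\mathscr{X}\to\mathbb{R}_+^{d-1}$, $g:\mathscr{X}\to\mathbb{R}_+$, and a continuous $\ell:\mathscr{X}\times\mathbb{R}_+^{d-1}\to\mathbb{R}_+$ for which there is $\gamma>0$ with $\tau\ell(x,\mu,a')+(1-\tau)\ell(x,\mu,a)-\ell(x,\mu,\tau a'+(1-\tau)a)\ge\gamma\tau(1-\tau)|a'-a|_2^2$ for all $(x,\mu)\in\mathscr{X}$, $a,a'\in\mathbb{R}_+^{d-1}$,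 $\tau\in[0,1]$. Controls and dynamics. $\mathscr{A}$ is the set of Lipschitz continuous functions $\alpha:[0,T]\times\mathscr{X}\to\mathbb{R}_+^{d-1}$. For $\alpha,\beta\in\mathscr{A}$ and $\varphi:\mathscr{X}\to\mathbb{R}$, $$(\mathscr{L}^\alpha_x\varphi)(t,x,\mu)=\sum_{y\ne x}(\lambda^0_y(x,\mu)+\lambda^1_y(x,\mu)\alpha_y(t,x,\mu))[\varphi(y,\mu)-\varphi(x,\mu)],$$ $$(\mathscr{L}^\beta_\mu\varphi)(t,x,\mu)=\sum_{y\ne z}n^\mu_z\big(\lambda^0_y(z,\mu+e_{x,z})+\lambda^1_y(z,\mu+e_{x,z})\beta_y(t,z,\mu+e_{x,z})\big)[\varphi(x,\mu+e_{y,z})-\varphi(x,\mu)]$$ (sum over ordered pairs $y\neq z$ in $\mathcal{X}$; terms with $n^\mu_z=0$ are zero). $\Xi_t=(X_t,\mu_t)$ is the time-inhomogeneous Markov chain on $\mathscr{X}$ with generator $\mathscr{L}^\alpha_x+\mathscr{L}^\beta_\mu$, and $\mathbb{E}^{\alpha\otimes\beta}$ its expectation. Set $J(t,x,\mu,\alpha;\beta)=\mathbb{E}^{\alpha\otimes\beta}\big[\int_t^T\ell(\Xi_u,\alpha(u,\Xi_u))\,du+g(\Xi_T)\,\big|\,\Xi_t=(x,\mu)\big]$ and $v^\beta(t,x,\mu)=\inf_{\alpha\in\mathscr{A}}J(t,x,\mu,\alpha;\beta)$. Hamiltonian and best response. For $\varphi:\mathcal{X}\to\mathbb{R}$, $\Delta_x\varphi=(\varphi(y)-\varphi(x))_{y\ne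 x}\in\mathbb{R}^{d-1}$. $H(x,\mu,p)=\inf_{a\in\mathbb{R}_+^{d-1}}\{\ell(x,\mu,a)+\sum_{y\ne x}(\lambda^0_y(x,\mu)+\lambda^1_y(x,\mu)a_y)p_y\}$, and $\hat\alpha(x,\mu,p)$ is its unique minimizer. It is classical that $v^\beta$ is the unique classical solution of $-\frac{d}{dt}v^\beta(t,x,\mu)=H(x,\mu,\Delta_xv^\beta(t,\cdot,\mu))+(\mathscr{L}^\beta_\mu v^\beta(t))(t,x,\mu)$, $v^\beta(T,x,\mu)=g(x,\mu)$. The best response to $\beta$ is $\alpha^*(\beta)(t,x,\mu)=\hat\alpha(x,\mu,\Delta_xv^\beta(t,\cdot,\mu))$, which lies in $\mathscr{A}$. $N$-NLL equation: $-\frac{d}{dt}v(t,x,\mu)=H(x,\mu,\Delta_xv(t,\cdot,\mu))+(\mathscr{L}^\alpha_\mu v(t))(t,x,\mu)$ with $\alpha(t,x,\mu)=\hat\alpha(x,\mu,\Delta_xv(t,\cdot,\mu))$ and $v(T,x,\mu)=g(x,\mu)$. It is known (Gomes–Mohr–Souza) that it has a unique classical solution $v$. The set $\mathscr{A}^*$: $c_a>0$ is a fixed constant such that $|\alpha^*(\beta)(t,x,\mu)|_2\le c_a$ for all $\beta\in\mathscr{A}$, $(t,x,\mu)\in[0,T]\times\mathscr{X}$ (such a constant exists), and $\mathscr{A}^*=\{\alpha\in\mathscr{A}:\sup_{t\in[0,T]}|\alpha(t)|_2\le c_a\}$. *)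

theory Defs
  imports "HOL-Probability.Probability"
begin

text \<open>
  The set \<open>{1,...,d}\<close> is rendered by an arbitrary finite type \<open>'d\<close>, so \<open>d = CARD('d)\<close>.
  A vector of \<open>\<real>\<^bsup>d-1\<^esup>\<close> attached to a state \<open>x\<close>, with entries indexed by \<open>y \<noteq> x\<close>, is rendered
  isometrically by the vector of \<open>real ^ 'd\<close> with the same entries and \<open>x\<close>-th entry \<open>0\<close>.
\<close>

type_synonym 'd state = "'d \<times> (real ^ 'd)"

type_synonym 'd control = "real \<Rightarrow> 'd state \<Rightarrow> real ^ 'd"

definition rates :: "'d::finite \<Rightarrow> (real ^ 'd) set" where
  "rates x = {a. a $ x = 0 \<and> (\<forall>y. 0 \<le> a $ y)}"

record ('d::finite) game =
  pop :: nat
  horizon :: real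
  rate0 :: "'d state \<Rightarrow> real ^ 'd"
  rate1 :: "'d state \<Rightarrow> real ^ 'd"
  run_cost :: "'d state \<Rightarrow> real ^ 'd \<Rightarrow> real"
  term_cost :: "'d state \<Rightarrow> real"

definition grid :: "'d::finite game \<Rightarrow> (real ^ 'd) set" where
  "grid G = {\<mu>. (\<forall>i. \<exists>k\<le>pop G. \<mu> $ i = real k / real (pop G)) \<and> (\<Sum>i\<in>UNIV. \<mu> $ i) = 1}"

definition states :: "'d::finite game \<Rightarrow> 'd state set" where
  "states G = UNIV \<times> grid G"

definition shift :: "'d::finite game \<Rightarrow> 'd \<Rightarrow> 'd \<Rightarrow> real ^ 'd" where
  "shift G x z = (1 / real (pop G)) *\<^sub>R (axis x 1 - axis z 1)"

definition standing_assumptions :: "'d::finite game \<Rightarrow> bool" where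
  "standing_assumptions G \<longleftrightarrow>
     0 < pop G \<and> 0 < horizon G \<and>
     (\<forall>\<xi>\<in>states G. rate0 G \<xi> \<in> rates (fst \<xi>) \<and> rate1 G \<xi> \<in> rates (fst \<xi>) \<and> 0 \<le> term_cost G \<xi>) \<and>
     (\<forall>\<xi>\<in>states G. continuous_on (rates (fst \<xi>)) (run_cost G \<xi>) \<and>
        (\<forall>a\<in>rates (fst \<xi>). 0 \<le> run_cost G \<xi> a)) \<and>
     (\<exists>\<gamma>>0. \<forall>\<xi>\<in>states G. \<forall>a\<in>rates (fst \<xi>). \<forall>a'\<in>rates (fst \<xi>). \<forall>\<tau>\<in>{0..1}.
        \<tau> * run_cost G \<xi> a' + (1 - \<tau>) * run_cost G \<xi> a - run_cost G \<xi> (\<tau> *\<^sub>R a' + (1 - \<tau>) *\<^sub>R a)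
          \<ge> \<gamma> * \<tau> * (1 - \<tau>) * (norm (a' - a))\<^sup>2)"

text \<open>
  The state space is finite and the time interval is bounded, so Lipschitz continuity on
  \<open>[0,T] \<times> states\<close> is Lipschitz continuity in time with a constant common to all states.
\<close>

definition controls :: "'d::finite game \<Rightarrow> 'd control set" where
  "controls G = {\<alpha>. (\<forall>t\<in>{0..horizon G}. \<forall>\<xi>\<in>states G. \<alpha> t \<xi> \<in> rates (fst \<xi>)) \<and>
                    (\<exists>L. \<forall>\<xi>\<in>states G. L-lipschitz_on {0..horizon G} (\<lambda>t. \<alpha> t \<xi>))}"

definition state_norm :: "'d::finite game \<Rightarrow> ('d state \<Rightarrow> 'v::real_normed_vector) \<Rightarrow> real" where
  "state_norm G \<psi> = L2_set (\<lambda>\<xi>. norm (\<psi> \<xi>)) (states G)"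

fun gen_x :: "'d::finite game \<Rightarrow> 'd control \<Rightarrow> ('d state \<Rightarrow> real) \<Rightarrow> real \<Rightarrow> 'd state \<Rightarrow> real" where
  "gen_x G \<alpha> \<phi> t (x, \<mu>) =
     (\<Sum>y\<in>UNIV - {x}. (rate0 G (x, \<mu>) $ y + rate1 G (x, \<mu>) $ y * \<alpha> t (x, \<mu>) $ y)
        * (\<phi> (y, \<mu>) - \<phi> (x, \<mu>)))"

text \<open>
  In the next sum \<open>N * \<mu>\<^sub>z\<close> is \<open>n\<^sub>z\<^sup>\<mu>\<close>. If it vanishes, \<open>\<mu> + shift G x z\<close> may lie outside
  the grid, where the data are unconstrained, but then the term is zero.
\<close>

fun gen_mu :: "'d::finite game \<Rightarrow> 'd control \<Rightarrow> ('d state \<Rightarrow> real) \<Rightarrow> real \<Rightarrow> 'd state \<Rightarrow> real" where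
  "gen_mu G \<beta> \<phi> t (x, \<mu>) =
     (\<Sum>(y, z)\<in>{(y, z). y \<noteq> z}. real (pop G) * \<mu> $ z
        * (rate0 G (z, \<mu> + shift G x z) $ y
           + rate1 G (z, \<mu> + shift G x z) $ y * \<beta> t (z, \<mu> + shift G x z) $ y)
        * (\<phi> (x, \<mu> + shift G y z) - \<phi> (x, \<mu>)))"

definition transition_function ::
    "'s set \<Rightarrow> real \<Rightarrow> (real \<Rightarrow> real \<Rightarrow> 's \<Rightarrow> 's \<Rightarrow> real) \<Rightarrow> bool" where
  "transition_function S T p \<longleftrightarrow>
     (\<forall>s u. 0 \<le> s \<and> s \<le> u \<and> u \<le> T \<longrightarrow>
        (\<forall>\<xi>\<in>S. (\<forall>\<eta>\<in>S. 0 \<le> p s u \<xi> \<eta>) \<and> (\<Sum>\<eta>\<in>S. p s u \<xi> \<eta>) = 1)) \<and>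
     (\<forall>s\<in>{0..T}. \<forall>\<xi>\<in>S. \<forall>\<eta>\<in>S. p s s \<xi> \<eta> = (if \<xi> = \<eta> then 1 else 0)) \<and>
     (\<forall>s r u. 0 \<le> s \<and> s \<le> r \<and> r \<le> u \<and> u \<le> T \<longrightarrow>
        (\<forall>\<xi>\<in>S. \<forall>\<eta>\<in>S. p s u \<xi> \<eta> = (\<Sum>\<zeta>\<in>S. p s r \<xi> \<zeta> * p r u \<zeta> \<eta>)))"

text \<open>
  Without time-homogeneity the limit over \<open>[u, u + h]\<close> alone would still allow jumps at
  deterministic times, hence the second limit over \<open>[u - h, u]\<close>.
\<close>

definition has_generator ::
    "'s set \<Rightarrow> real \<Rightarrow> (real \<Rightarrow> real \<Rightarrow> 's \<Rightarrow> 's \<Rightarrow> real) \<Rightarrow>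
     (('s \<Rightarrow> real) \<Rightarrow> real \<Rightarrow> 's \<Rightarrow> real) \<Rightarrow> bool" where
  "has_generator S T p L \<longleftrightarrow>
     (\<forall>\<phi>. \<forall>\<xi>\<in>S.
        (\<forall>u\<in>{0..<T}.
           ((\<lambda>h. ((\<Sum>\<eta>\<in>S. p u (u + h) \<xi> \<eta> * \<phi> \<eta>) - \<phi> \<xi>) / h) \<longlongrightarrow> L \<phi> u \<xi>) (at_right 0)) \<and>
        (\<forall>u\<in>{0<..T}.
           ((\<lambda>h. ((\<Sum>\<eta>\<in>S. p (u - h) u \<xi> \<eta> * \<phi> \<eta>) - \<phi> \<xi>) / h) \<longlongrightarrow> L \<phi> u \<xi>) (at_right 0)))"

definition past :: "'w measure \<Rightarrow> (real \<Rightarrow> 'w \<Rightarrow> 's) \<Rightarrow> real \<Rightarrow> real \<Rightarrow> 'w measure" where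
  "past M X t s = sigma (space M) {X r -` B \<inter> space M | r B. t \<le> r \<and> r \<le> s}"

text \<open>
  In \<open>markov_chain S T L t \<xi> M X\<close> only the values of \<open>X\<close> on \<open>[t,T]\<close> matter, and right-continuity of
  paths refers to the discrete topology of \<open>S\<close>.
\<close>

definition markov_chain ::
    "'s set \<Rightarrow> real \<Rightarrow> (('s \<Rightarrow> real) \<Rightarrow> real \<Rightarrow> 's \<Rightarrow> real) \<Rightarrow> real \<Rightarrow> 's \<Rightarrow>
     'w measure \<Rightarrow> (real \<Rightarrow> 'w \<Rightarrow> 's) \<Rightarrow> bool" where
  "markov_chain S T L t \<xi> M X \<longleftrightarrow>
     prob_space M \<and>
     (\<forall>u\<in>{t..T}. X u \<in> measurable M (count_space S)) \<and>
     (\<forall>\<omega>\<in>space M. \<forall>u\<in>{t..<T}. \<forall>\<^sub>F r in at_right u. X r \<omega> = X u \<omega>) \<and>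
     (AE \<omega> in M. X t \<omega> = \<xi>) \<and>
     (\<exists>p. transition_function S T p \<and> has_generator S T p L \<and>
        (\<forall>s u. t \<le> s \<and> s \<le> u \<and> u \<le> T \<longrightarrow> (\<forall>\<eta>\<in>S.
           AE \<omega> in M. real_cond_exp M (past M X t s) (\<lambda>\<omega>. if X u \<omega> = \<eta> then 1 else 0) \<omega>
             = p s u (X s \<omega>) \<eta>)))"

text \<open>
  \<open>P \<alpha> \<beta> t \<xi>\<close> is the law of the game in which the tagged player uses \<open>\<alpha>\<close> and all others use \<open>\<beta>\<close>,
  started from \<open>\<xi>\<close> at time \<open>t\<close>, i.e. conditioned on \<open>\<Xi>\<^sub>t = \<xi>\<close>. The underlying space and process
  \<open>\<Xi>\<close> are arbitrary.
\<close>

type_synonym ('d, 'w) laws =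
  "'d control \<Rightarrow> 'd control \<Rightarrow> real \<Rightarrow> 'd state \<Rightarrow> 'w measure"

definition game_process ::
    "'d::finite game \<Rightarrow> ('d, 'w) laws \<Rightarrow> (real \<Rightarrow> 'w \<Rightarrow> 'd state) \<Rightarrow> bool" where
  "game_process G P \<Xi> \<longleftrightarrow>
     (\<forall>\<alpha>\<in>controls G. \<forall>\<beta>\<in>controls G. \<forall>t\<in>{0..horizon G}. \<forall>\<xi>\<in>states G.
        markov_chain (states G) (horizon G)
          (\<lambda>\<phi> u \<zeta>. gen_x G \<alpha> \<phi> u \<zeta> + gen_mu G \<beta> \<phi> u \<zeta>) t \<xi> (P \<alpha> \<beta> t \<xi>) \<Xi>)"

definition cost ::
    "'d::finite game \<Rightarrow> ('d, 'w) laws \<Rightarrow> (real \<Rightarrow> 'w \<Rightarrow> 'd state) \<Rightarrow>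
     real \<Rightarrow> 'd state \<Rightarrow> 'd control \<Rightarrow> 'd control \<Rightarrow> real" where
  "cost G P \<Xi> t \<xi> \<alpha> \<beta> =
     (\<integral>\<omega>. ((LINT u:{t..horizon G}|lborel. run_cost G (\<Xi> u \<omega>) (\<alpha> u (\<Xi> u \<omega>)))
          + term_cost G (\<Xi> (horizon G) \<omega>)) \<partial>(P \<alpha> \<beta> t \<xi>))"

definition best_value ::
    "'d::finite game \<Rightarrow> ('d, 'w) laws \<Rightarrow> (real \<Rightarrow> 'w \<Rightarrow> 'd state) \<Rightarrow>
     'd control \<Rightarrow> real \<Rightarrow> 'd state \<Rightarrow> real" where
  "best_value G P \<Xi> \<beta> t \<xi> = (INF \<alpha>\<in>controls G. cost G P \<Xi> t \<xi> \<alpha> \<beta>)"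

fun diff_x :: "('d::finite state \<Rightarrow> real) \<Rightarrow> 'd state \<Rightarrow> real ^ 'd" where
  "diff_x \<phi> (x, \<mu>) = (\<chi> y. \<phi> (y, \<mu>) - \<phi> (x, \<mu>))"

definition pre_hamiltonian ::
    "'d::finite game \<Rightarrow> 'd state \<Rightarrow> real ^ 'd \<Rightarrow> real ^ 'd \<Rightarrow> real" where
  "pre_hamiltonian G \<xi> p a = run_cost G \<xi> a
     + (\<Sum>y\<in>UNIV - {fst \<xi>}. (rate0 G \<xi> $ y + rate1 G \<xi> $ y * a $ y) * p $ y)"

definition hamiltonian :: "'d::finite game \<Rightarrow> 'd state \<Rightarrow> real ^ 'd \<Rightarrow> real" where
  "hamiltonian G \<xi> p = (INF a\<in>rates (fst \<xi>). pre_hamiltonian G \<xi> p a)"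

definition opt_rate :: "'d::finite game \<Rightarrow> 'd state \<Rightarrow> real ^ 'd \<Rightarrow> real ^ 'd" where
  "opt_rate G \<xi> p = (THE a. is_arg_min (pre_hamiltonian G \<xi> p) (\<lambda>a. a \<in> rates (fst \<xi>)) a)"

definition best_response ::
    "'d::finite game \<Rightarrow> ('d, 'w) laws \<Rightarrow> (real \<Rightarrow> 'w \<Rightarrow> 'd state) \<Rightarrow> 'd control \<Rightarrow> 'd control" where
  "best_response G P \<Xi> \<beta> t \<xi> = opt_rate G \<xi> (diff_x (best_value G P \<Xi> \<beta> t) \<xi>)"

text \<open>
  The time derivative is one-sided at \<open>0\<close> and \<open>T\<close>. Its continuity need not be required,
  since the right-hand side is continuous in time along a differentiable \<open>v\<close>.
\<close>

definition NLL_solution :: "'d::finite game \<Rightarrow> (real \<Rightarrow> 'd state \<Rightarrow> real) \<Rightarrow> bool" where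
  "NLL_solution G v \<longleftrightarrow>
     (\<forall>\<xi>\<in>states G. v (horizon G) \<xi> = term_cost G \<xi> \<and>
        (\<forall>t\<in>{0..horizon G}.
           ((\<lambda>s. v s \<xi>) has_real_derivative
              - (hamiltonian G \<xi> (diff_x (v t) \<xi>)
                 + gen_mu G (\<lambda>s \<zeta>. opt_rate G \<zeta> (diff_x (v s) \<zeta>)) (v t) t \<xi>))
             (at t within {0..horizon G})))"

definition best_response_bound ::
    "'d::finite game \<Rightarrow> ('d, 'w) laws \<Rightarrow> (real \<Rightarrow> 'w \<Rightarrow> 'd state) \<Rightarrow> real \<Rightarrow> bool" where
  "best_response_bound G P \<Xi> c \<longleftrightarrow> 0 < c \<and>
     (\<forall>\<beta>\<in>controls G. \<forall>t\<in>{0..horizon G}. \<forall>\<xi>\<in>states G. norm (best_response G P \<Xi> \<beta> t \<xi>) \<le> c)"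

definition bounded_controls :: "'d::finite game \<Rightarrow> real \<Rightarrow> 'd control set" where
  "bounded_controls G c = {\<alpha> \<in> controls G. \<forall>t\<in>{0..horizon G}. state_norm G (\<alpha> t) \<le> c}"

fun beta_iter ::
    "'d::finite game \<Rightarrow> ('d, 'w) laws \<Rightarrow> (real \<Rightarrow> 'w \<Rightarrow> 'd state) \<Rightarrow>
     real \<Rightarrow> 'd control \<Rightarrow> nat \<Rightarrow> 'd control" where
  "beta_iter G P \<Xi> \<rho> \<beta>0 0 = \<beta>0"
| "beta_iter G P \<Xi> \<rho> \<beta>0 (Suc n) =
     (\<lambda>t \<xi>. \<rho> *\<^sub>R beta_iter G P \<Xi> \<rho> \<beta>0 n t \<xi>
            + (1 - \<rho>) *\<^sub>R best_response G P \<Xi> (beta_iter G P \<Xi> \<rho> \<beta>0 n) t \<xi>)"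

text \<open>\<open>v_iter\<close> is only meaningful for \<open>n \<ge> 1\<close>.\<close>

definition v_iter ::
    "'d::finite game \<Rightarrow> ('d, 'w) laws \<Rightarrow> (real \<Rightarrow> 'w \<Rightarrow> 'd state) \<Rightarrow>
     real \<Rightarrow> 'd control \<Rightarrow> nat \<Rightarrow> real \<Rightarrow> 'd state \<Rightarrow> real" where
  "v_iter G P \<Xi> \<rho> \<beta>0 n = best_value G P \<Xi> (beta_iter G P \<Xi> \<rho> \<beta>0 (n - 1))"

end

(*
  Dynkin's formula, applied to sub- and supersolutions w of the Hamilton-Jacobi-Bellman equation,
  bounds the cost of every control from below and that of the feedback control from above.
  Against a control beta that is within B exp(theta (T - t)) of the equilibrium control a, the
  functions v -+ K B exp(theta (T - t)) / theta are such sub- and supersolutions, so the value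
  function against beta is that close to v, and by Lipschitz dependence of the minimiser on the
  gradient the best response to beta is within K' B exp(theta (T - t)) / theta of a.
  One step of the iteration thus multiplies the error by rho + (1 - rho) K' / theta, and theta can be
  chosen to push this factor below any q > rho: take q = sqrt rho for rho > 0 and q = eta for rho = 0.
*)
theory Submission
  imports Defs
begin

section \<open>Markov chains and Dynkin's formula\<close>

text \<open>The weight \<open>exp (\<theta> * (T - t))\<close> fits because influence runs backwards
  in time: the value at time \<open>t\<close> feels the deviation of the population on
  \<open>[t, T]\<close> only, and the weight integrates over that interval to at most
  \<open>1 / \<theta>\<close> times its value at \<open>t\<close>. This gain is worth something only
  if the factor in front depends neither on \<open>\<theta>\<close> nor on the iterate. It does not,
  for two reasons. The deviation of \<open>\<beta>\<close> enters linearly and is tested against the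
  fixed function \<open>v\<close>, so only a sup bound on \<open>v\<close> appears. The minimiser is
  globally Lipschitz in the gradient, although the Lipschitz bound for the Hamiltonian itself grows
  with the size of the rates. A separate obstacle is that the best response is defined through an
  infimum of expected costs, while the next step of the iteration requires it to be a Lipschitz
  control. This is why the Hamilton-Jacobi-Bellman equation against an arbitrary control has to be
  solved: verification identifies its solution with the value function, and the feedback of a
  solution is Lipschitz in time.\<close>

lemma transition_function_le_1:
  assumes "finite S" "transition_function S T p" "0 \<le> s" "s \<le> u" "u \<le> T" "\<xi> \<in> S" "\<eta> \<in> S"
  shows "p s u \<xi> \<eta> \<le> 1"
proof -
  have "p s u \<xi> \<eta> \<le> (\<Sum>\<eta>\<in>S. p s u \<xi> \<eta>)"
    using assms by (intro member_le_sum) (auto simp: transition_function_def)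
  also have "\<dots> = 1"
    using assms by (auto simp: transition_function_def)
  finally show ?thesis .
qed

lemma chapman_kolmogorov:
  assumes "finite S" "transition_function S T p" "0 \<le> s" "s \<le> r" "r \<le> u" "u \<le> T" "\<xi> \<in> S"
  shows "(\<Sum>\<eta>\<in>S. p s u \<xi> \<eta> * \<phi> \<eta>) = (\<Sum>\<zeta>\<in>S. p s r \<xi> \<zeta> * (\<Sum>\<eta>\<in>S. p r u \<zeta> \<eta> * \<phi> \<eta>))"
proof -
  have "(\<Sum>\<eta>\<in>S. p s u \<xi> \<eta> * \<phi> \<eta>) = (\<Sum>\<eta>\<in>S. (\<Sum>\<zeta>\<in>S. p s r \<xi> \<zeta> * p r u \<zeta> \<eta>) * \<phi> \<eta>)"
    using assms unfolding transition_function_def by (intro sum.cong) auto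
  also have "\<dots> = (\<Sum>\<eta>\<in>S. \<Sum>\<zeta>\<in>S. p s r \<xi> \<zeta> * (p r u \<zeta> \<eta> * \<phi> \<eta>))"
    by (simp add: sum_distrib_right mult.assoc)
  also have "\<dots> = (\<Sum>\<zeta>\<in>S. p s r \<xi> \<zeta> * (\<Sum>\<eta>\<in>S. p r u \<zeta> \<eta> * \<phi> \<eta>))"
    by (subst sum.swap) (simp add: sum_distrib_left)
  finally show ?thesis .
qed

text \<open>By Chapman-Kolmogorov the quotient to the right of \<open>u\<close> is the average under
  \<open>p s u \<xi>\<close> of the generator quotients at \<open>u\<close>. These weights do not
  depend on the step \<open>h\<close>, so the limit passes through the finite sum.\<close>

lemma forward_right:
  assumes S: "finite S" "transition_function S T p" "has_generator S T p L"
    and "0 \<le> s" "s \<le> u" "u < T" "\<xi> \<in> S"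
  shows "((\<lambda>y. \<Sum>\<eta>\<in>S. p s y \<xi> \<eta> * \<phi> \<eta>) has_real_derivative (\<Sum>\<eta>\<in>S. p s u \<xi> \<eta> * L \<phi> u \<eta>))
           (at_right u)"
proof -
  define F where "F y = (\<Sum>\<eta>\<in>S. p s y \<xi> \<eta> * \<phi> \<eta>)" for y
  have "((\<lambda>h. \<Sum>\<zeta>\<in>S. p s u \<xi> \<zeta> * (((\<Sum>\<eta>\<in>S. p u (u + h) \<zeta> \<eta> * \<phi> \<eta>) - \<phi> \<zeta>) / h))
          \<longlongrightarrow> (\<Sum>\<eta>\<in>S. p s u \<xi> \<eta> * L \<phi> u \<eta>)) (at_right 0)"
    using assms unfolding has_generator_def by (intro tendsto_sum tendsto_mult tendsto_const) auto
  moreover have "\<forall>\<^sub>F h in at_right 0. h \<in> {0<..<T - u}"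
    using \<open>u < T\<close> by (intro eventually_at_right_real) simp
  then have "\<forall>\<^sub>F h in at_right 0.
      (\<Sum>\<zeta>\<in>S. p s u \<xi> \<zeta> * (((\<Sum>\<eta>\<in>S. p u (u + h) \<zeta> \<eta> * \<phi> \<eta>) - \<phi> \<zeta>) / h)) = (F (h + u) - F u) / h"
  proof eventually_elim
    case (elim h)
    have "F (h + u) = (\<Sum>\<zeta>\<in>S. p s u \<xi> \<zeta> * (\<Sum>\<eta>\<in>S. p u (u + h) \<zeta> \<eta> * \<phi> \<eta>))"
      unfolding F_def using elim assms by (subst chapman_kolmogorov[of S T p s u]) (auto simp: add.commute)
    then show ?case
      by (simp add: F_def right_diff_distrib sum_subtractf flip: sum_divide_distrib)
  qed
  ultimately have "((\<lambda>h. (F (h + u) - F u) / h) \<longlongrightarrow> (\<Sum>\<eta>\<in>S. p s u \<xi> \<eta> * L \<phi> u \<eta>)) (at_right 0)"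
    by (rule Lim_transform_eventually)
  then show ?thesis
    unfolding has_field_derivative_iff F_def[symmetric]
    by (subst filterlim_at_right_to_0) simp
qed

text \<open>Here the averaging weights \<open>p s (u - h) \<xi>\<close> move with \<open>h\<close>,
  so left continuity of the transition probabilities at \<open>u\<close> has to be established
  before the limit can be taken.\<close>

lemma forward_left:
  assumes S: "finite S" "transition_function S T p" "has_generator S T p L"
    and "0 \<le> s" "s < u" "u \<le> T" "\<xi> \<in> S"
  shows "((\<lambda>y. \<Sum>\<eta>\<in>S. p s y \<xi> \<eta> * \<phi> \<eta>) has_real_derivative (\<Sum>\<eta>\<in>S. p s u \<xi> \<eta> * L \<phi> u \<eta>))
           (at_left u)"
proof -
  define Q where "Q \<phi> h \<zeta> = ((\<Sum>\<eta>\<in>S. p (u - h) u \<zeta> \<eta> * \<phi> \<eta>) - \<phi> \<zeta>) / h" for \<phi> h \<zeta>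
  have Q: "((\<lambda>h. Q \<phi> h \<zeta>) \<longlongrightarrow> L \<phi> u \<zeta>) (at_right 0)" if "\<zeta> \<in> S" for \<phi> \<zeta>
    using assms that unfolding has_generator_def Q_def by auto
  define F where "F \<phi> y = (\<Sum>\<eta>\<in>S. p s y \<xi> \<eta> * \<phi> \<eta>)" for \<phi> y
  have ev: "\<forall>\<^sub>F h in at_right 0. h \<in> {0<..<u - s}"
    using eventually_at_right_real[of 0 "u - s"] \<open>s < u\<close> by simp
  have F: "F \<phi> u - F \<phi> (u - h) = h * (\<Sum>\<zeta>\<in>S. p s (u - h) \<xi> \<zeta> * Q \<phi> h \<zeta>)"
    if h: "h \<in> {0<..<u - s}" for h \<phi>
  proof -
    have "F \<phi> u = (\<Sum>\<zeta>\<in>S. p s (u - h) \<xi> \<zeta> * (\<Sum>\<eta>\<in>S. p (u - h) u \<zeta> \<eta> * \<phi> \<eta>))"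
      unfolding F_def using h assms by (subst chapman_kolmogorov[of S T p s "u - h"]) auto
    moreover have "h * (\<Sum>\<zeta>\<in>S. p s (u - h) \<xi> \<zeta> * Q \<phi> h \<zeta>)
        = (\<Sum>\<zeta>\<in>S. p s (u - h) \<xi> \<zeta> * ((\<Sum>\<eta>\<in>S. p (u - h) u \<zeta> \<eta> * \<phi> \<eta>) - \<phi> \<zeta>))"
      using h by (simp add: Q_def sum_distrib_left[of h])
    ultimately show ?thesis
      by (simp add: F_def right_diff_distrib sum_subtractf)
  qed
  \<comment> \<open>For the indicator of \<open>\<zeta>\<close>, the identity \<open>F\<close>
    bounds the increment by \<open>h\<close> times a sum of convergent quotients, the weights being
    at most 1.\<close>
  have cont: "((\<lambda>h. p s (u - h) \<xi> \<zeta>) \<longlongrightarrow> p s u \<xi> \<zeta>) (at_right 0)" if "\<zeta> \<in> S" for \<zeta>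
  proof -
    define \<psi> where "\<psi> = (\<lambda>\<eta>. if \<eta> = \<zeta> then 1 else 0 :: real)"
    have F\<psi>: "F \<psi> y = p s y \<xi> \<zeta>" for y
      using that S by (simp add: F_def \<psi>_def if_distrib[of "\<lambda>x. _ * x"] sum.delta' cong: if_cong)
    have lim: "((\<lambda>h. h * (\<Sum>\<zeta>\<in>S. \<bar>Q \<psi> h \<zeta>\<bar>)) \<longlongrightarrow> 0 * (\<Sum>\<zeta>\<in>S. \<bar>L \<psi> u \<zeta>\<bar>)) (at_right 0)"
      by (intro tendsto_intros Q)
    have "\<forall>\<^sub>F h in at_right 0. norm (F \<psi> (u - h) - F \<psi> u) \<le> h * (\<Sum>\<zeta>\<in>S. \<bar>Q \<psi> h \<zeta>\<bar>)"
      using ev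
    proof eventually_elim
      case (elim h)
      have "\<bar>\<Sum>\<zeta>\<in>S. p s (u - h) \<xi> \<zeta> * Q \<psi> h \<zeta>\<bar> \<le> (\<Sum>\<zeta>\<in>S. \<bar>Q \<psi> h \<zeta>\<bar>)"
      proof (intro order_trans[OF sum_abs] sum_mono)
        fix \<zeta> assume "\<zeta> \<in> S"
        then have "0 \<le> p s (u - h) \<xi> \<zeta>" "p s (u - h) \<xi> \<zeta> \<le> 1"
          using elim assms transition_function_le_1[of S T p s "u - h" \<xi> \<zeta>] by (auto simp: transition_function_def)
        then show "\<bar>p s (u - h) \<xi> \<zeta> * Q \<psi> h \<zeta>\<bar> \<le> \<bar>Q \<psi> h \<zeta>\<bar>"
          by (simp add: abs_mult mult_left_le_one_le)
      qed
      then show ?case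
        using F[OF elim, of \<psi>] elim by (simp add: abs_minus_commute[of "F \<psi> (u - h)"] abs_mult)
    qed
    from Lim_null_comparison[OF this] lim
    have "((\<lambda>h. F \<psi> (u - h) - F \<psi> u) \<longlongrightarrow> 0) (at_right 0)"
      by simp
    then show ?thesis
      by (simp add: F\<psi> LIM_zero_iff)
  qed
  have "((\<lambda>h. \<Sum>\<zeta>\<in>S. p s (u - h) \<xi> \<zeta> * Q \<phi> h \<zeta>) \<longlongrightarrow> (\<Sum>\<eta>\<in>S. p s u \<xi> \<eta> * L \<phi> u \<eta>)) (at_right 0)"
    by (intro tendsto_sum tendsto_mult cont Q)
  moreover have "\<forall>\<^sub>F h in at_right 0.
      (\<Sum>\<zeta>\<in>S. p s (u - h) \<xi> \<zeta> * Q \<phi> h \<zeta>) = (F \<phi> (u - h) - F \<phi> u) / (u - h - u)"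
    using ev
  proof eventually_elim
    case (elim h)
    then show ?case using F[OF elim, of \<phi>] by (simp add: field_simps)
  qed
  ultimately have "((\<lambda>h. (F \<phi> (u - h) - F \<phi> u) / (u - h - u)) \<longlongrightarrow> (\<Sum>\<eta>\<in>S. p s u \<xi> \<eta> * L \<phi> u \<eta>)) (at_right 0)"
    by (rule Lim_transform_eventually)
  then show ?thesis
    unfolding has_field_derivative_iff F_def[symmetric]
    by (subst filterlim_at_left_to_right, subst filterlim_at_right_to_0) simp
qed

lemma kolmogorov_forward:
  assumes S: "finite S" "transition_function S T p" "has_generator S T p L"
    and "0 \<le> s" "s \<le> u" "u \<le> T" "\<xi> \<in> S"
  shows "((\<lambda>y. \<Sum>\<eta>\<in>S. p s y \<xi> \<eta> * \<phi> \<eta>) has_real_derivative (\<Sum>\<eta>\<in>S. p s u \<xi> \<eta> * L \<phi> u \<eta>))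
           (at u within {s..T})"
proof -
  have eq: "{s..T} = {s..u} \<union> {u..T}" using assms by auto
  have "at u within {s..u} = bot \<or> s < u \<and> at u within {s..u} = at_left u"
    using assms by (cases "s = u") (auto simp: at_within_Icc_at_left at_within_eq_bot_iff)
  moreover have "at u within {u..T} = bot \<or> u < T \<and> at u within {u..T} = at_right u"
    using assms by (cases "u = T") (auto simp: at_within_Icc_at_right at_within_eq_bot_iff)
  ultimately show ?thesis
    unfolding eq has_field_derivative_iff Lim_within_Un
    using forward_left[OF S, of s u \<xi> \<phi>] forward_right[OF S, of s u \<xi> \<phi>] assms
    unfolding has_field_derivative_iff by auto
qed

lemma dynkin:
  assumes S: "finite S" "transition_function S T p" "has_generator S T p L"
    and "0 \<le> s" "s \<le> u" "u \<le> T" "\<xi> \<in> S"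
    and w: "\<And>\<eta>. \<eta> \<in> S \<Longrightarrow> ((\<lambda>y. w y \<eta>) has_real_derivative w' \<eta>) (at u within {0..T})"
  shows "((\<lambda>y. \<Sum>\<eta>\<in>S. p s y \<xi> \<eta> * w y \<eta>) has_real_derivative
           (\<Sum>\<eta>\<in>S. p s u \<xi> \<eta> * (w' \<eta> + L (w u) u \<eta>))) (at u within {s..T})"
proof -
  have p: "\<exists>D. ((\<lambda>y. p s y \<xi> \<eta>) has_real_derivative D) (at u within {s..T})" if "\<eta> \<in> S" for \<eta>
    using kolmogorov_forward[OF assms(1-7), of "\<lambda>\<zeta>. if \<zeta> = \<eta> then 1 else 0"] that S
    by (auto simp: if_distrib[of "\<lambda>x. _ * x"] sum.delta' cong: if_cong)
  have "((\<lambda>y. \<Sum>\<eta>\<in>S. p s y \<xi> \<eta> * (w y \<eta> - w u \<eta>)) has_real_derivative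
          (\<Sum>\<eta>\<in>S. p s u \<xi> \<eta> * w' \<eta>)) (at u within {s..T})"
  proof (rule DERIV_sum)
    fix \<eta> assume \<eta>: "\<eta> \<in> S"
    obtain D where D: "((\<lambda>y. p s y \<xi> \<eta>) has_real_derivative D) (at u within {s..T})"
      using p[OF \<eta>] by blast
    have "((\<lambda>y. w y \<eta>) has_real_derivative w' \<eta>) (at u within {s..T})"
      by (rule DERIV_subset[OF w[OF \<eta>]]) (use assms in auto)
    then show "((\<lambda>y. p s y \<xi> \<eta> * (w y \<eta> - w u \<eta>)) has_real_derivative p s u \<xi> \<eta> * w' \<eta>) (at u within {s..T})"
      using D by (auto intro!: derivative_eq_intros)
  qed
  from DERIV_add[OF this kolmogorov_forward[OF assms(1-7), of "w u"]]
  show ?thesis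
    by (simp add: right_diff_distrib distrib_left sum.distrib sum_subtractf)
qed

section \<open>Marginals and expected costs of the chain\<close>

lemma markov_chain_marginal:
  assumes S: "finite S" "\<xi> \<in> S" and chain: "markov_chain S T L t \<xi> M X" and "0 \<le> t" "t \<le> T"
  obtains p where "transition_function S T p" "has_generator S T p L"
    "\<And>u \<eta>. u \<in> {t..T} \<Longrightarrow> \<eta> \<in> S \<Longrightarrow> measure M {\<omega> \<in> space M. X u \<omega> = \<eta>} = p t u \<xi> \<eta>"
proof -
  interpret prob_space M using chain by (simp add: markov_chain_def)
  obtain p where p: "transition_function S T p" "has_generator S T p L"
    and markov: "\<forall>s u. t \<le> s \<and> s \<le> u \<and> u \<le> T \<longrightarrow> (\<forall>\<eta>\<in>S.
        AE \<omega> in M. real_cond_exp M (past M X t s) (\<lambda>\<omega>. if X u \<omega> = \<eta> then 1 else 0) \<omega> = p s u (X s \<omega>) \<eta>)"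
    using chain unfolding markov_chain_def by (elim conjE exE) (rule that)
  have cond: "AE \<omega> in M. real_cond_exp M (past M X t t) (\<lambda>\<omega>. if X u \<omega> = \<eta> then 1 else 0) \<omega> = p t u (X t \<omega>) \<eta>"
    if "t \<le> u" "u \<le> T" "\<eta> \<in> S" for u \<eta>
    using markov[rule_format, of t u] that by simp
  have X: "X u \<in> measurable M (count_space S)" if "u \<in> {t..T}" for u
    using chain that by (auto simp: markov_chain_def)
  have start: "AE \<omega> in M. X t \<omega> = \<xi>"
    using chain by (auto simp: markov_chain_def)
  \<comment> \<open>The generators of \<open>past\<close> use arbitrary sets \<open>B\<close>,
    whereas measurability of \<open>X t\<close> concerns subsets of \<open>S\<close>.\<close>
  have "X t -` B \<inter> space M \<in> sets M" for B
  proof -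
    have "X t -` B \<inter> space M = X t -` (B \<inter> S) \<inter> space M"
      using measurable_space[OF X[of t]] assms by auto
    then show ?thesis
      using measurable_sets[OF X[of t], of "B \<inter> S"] assms by simp
  qed
  then have "subalgebra M (past M X t t)"
    unfolding subalgebra_def past_def
    by (auto intro!: sets.sigma_sets_subset simp: space_measure_of_conv sets_measure_of_conv)
  then interpret finite_measure_subalgebra M "past M X t t"
    by unfold_locales
  show thesis
  proof (rule that[OF p])
    fix u \<eta> assume u: "u \<in> {t..T}" and \<eta>: "\<eta> \<in> S"
    have meas: "{\<omega> \<in> space M. X u \<omega> = \<eta>} \<in> sets M"
      using measurable_sets[OF X[OF u], of "{\<eta>}"] \<eta> by (simp add: vimage_def Int_def conj_commute)
    have ind: "(if X u \<omega> = \<eta> then 1 else 0 :: real) = indicator {\<omega> \<in> space M. X u \<omega> = \<eta>} \<omega>"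
      if "\<omega> \<in> space M" for \<omega> using that by simp
    have intg: "integrable M (\<lambda>\<omega>. if X u \<omega> = \<eta> then 1 else 0 :: real)"
      using meas by (subst Bochner_Integration.integrable_cong[OF refl ind]) (auto simp: emeasure_eq_measure)
    have "measure M {\<omega> \<in> space M. X u \<omega> = \<eta>} = (\<integral>\<omega>. (if X u \<omega> = \<eta> then 1 else 0) \<partial>M)"
      using meas by (subst Bochner_Integration.integral_cong[OF refl ind]) auto
    \<comment> \<open>Conditioning at the starting time preserves the mean, and there the chain sits
      at \<open>\<xi>\<close> almost surely, which turns the conditional probability into a
      constant.\<close>
    also have "\<dots> = (\<integral>\<omega>. real_cond_exp M (past M X t t) (\<lambda>\<omega>. if X u \<omega> = \<eta> then 1 else 0) \<omega> \<partial>M)"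
      using real_cond_exp_int(2)[OF intg] by simp
    also have "\<dots> = (\<integral>\<omega>. p t u \<xi> \<eta> \<partial>M)"
      using start cond[of u \<eta>] u \<eta> by (intro integral_cong_AE) auto
    finally show "measure M {\<omega> \<in> space M. X u \<omega> = \<eta>} = p t u \<xi> \<eta>"
      by (simp add: prob_space)
  qed
qed

text \<open>Sampling the path at the next point of a time grid of mesh \<open>1 / (n + 1)\<close>
  gives measurable approximations, since the sampling index takes countably many values. Right
  continuity in the discrete topology makes them eventually equal to the indicator itself.\<close>

lemma markov_chain_measurable:
  fixes X :: "real \<Rightarrow> 'w \<Rightarrow> 's"
  assumes chain: "markov_chain S T L t \<xi> M X" and "\<eta> \<in> S"
  shows "(\<lambda>x. if fst x \<in> {t..T} \<and> X (fst x) (snd x) = \<eta> then 1 else 0 :: real)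
           \<in> borel_measurable (lborel \<Otimes>\<^sub>M M)"
proof (cases "t \<le> T")
  case False
  then show ?thesis by simp
next
  case tT: True
  \<comment> \<open>For \<open>u < T\<close> the \<open>+ 1\<close> puts the sampling time strictly
    to the right of \<open>u\<close>, where right continuity acts; the clamping keeps it in
    \<open>[t, T]\<close>.\<close>
  define r where "r n i = max t (min T (t + (of_int i + 1) / (real n + 1)))" for n :: nat and i :: int
  define K where "K n i x = (if fst x \<in> {t..T} \<and> X (r n i) (snd x) = \<eta> then 1 else 0 :: real)"
    for n i and x :: "real \<times> 'w"
  define J where "J n x = \<lfloor>(fst x - t) * (real n + 1)\<rfloor>" for n :: nat and x :: "real \<times> 'w"
  show ?thesis
  proof (rule borel_measurable_LIMSEQ_real)
    fix n
    have [measurable]: "X (r n i) \<in> measurable M (count_space S)" for i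
      using chain tT by (auto simp: markov_chain_def r_def)
    have "{\<omega> \<in> space M. X (r n i) \<omega> = \<eta>} \<in> sets M" for i
      using measurable_sets[OF \<open>X (r n i) \<in> _\<close>, of "{\<eta>}"] \<open>\<eta> \<in> S\<close>
      by (simp add: vimage_def Int_def conj_commute)
    then have [measurable]: "Measurable.pred M (\<lambda>\<omega>. X (r n i) \<omega> = \<eta>)" for i
      by (simp add: pred_def)
    have "K n i \<in> borel_measurable (lborel \<Otimes>\<^sub>M M)" for i
      unfolding K_def[abs_def] by measurable
    moreover have "J n \<in> measurable (lborel \<Otimes>\<^sub>M M) (count_space UNIV)"
      unfolding J_def[abs_def] by measurable
    ultimately show "(\<lambda>x. K n (J n x) x) \<in> borel_measurable (lborel \<Otimes>\<^sub>M M)"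
      by (rule measurable_compose_countable)
  next
    fix x :: "real \<times> 'w" assume "x \<in> space (lborel \<Otimes>\<^sub>M M)"
    then obtain u \<omega> where x: "x = (u, \<omega>)" and \<omega>: "\<omega> \<in> space M"
      by (auto simp: space_pair_measure)
    show "(\<lambda>n. K n (J n x) x) \<longlonglongrightarrow> (if fst x \<in> {t..T} \<and> X (fst x) (snd x) = \<eta> then 1 else 0)"
    proof (cases "u \<in> {t..T}")
      case False
      then show ?thesis by (auto simp: x K_def)
    next
      case u: True
      have lower: "u < t + (of_int (J n x) + 1) / (real n + 1)" for n
      proof -
        have "(u - t) * (real n + 1) < of_int (J n x) + 1"
          by (simp add: J_def x)
        then show ?thesis
          by (simp add: field_simps)
      qed
      have upper: "t + (of_int (J n x) + 1) / (real n + 1) \<le> u + 1 / (real n + 1)" for n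
      proof -
        have "of_int (J n x) \<le> (u - t) * (real n + 1)"
          by (simp add: J_def x)
        then have "of_int (J n x) / (real n + 1) \<le> u - t"
          by (subst pos_divide_le_eq) auto
        then show ?thesis
          by (simp add: add_divide_distrib)
      qed
      show ?thesis
      proof (cases "u = T")
        case True
        \<comment> \<open>Right continuity says nothing at \<open>T\<close>, but there the clamped
          sampling time is \<open>T\<close> itself.\<close>
        have "r n (J n x) = T" for n
          using lower[of n] True tT by (simp add: r_def)
        then show ?thesis by (simp add: K_def x True tT)
      next
        case False
        with u have "u < T" by simp
        have gt: "u < r n (J n x)" for n
          using lower[of n] u \<open>u < T\<close> by (auto simp: r_def less_max_iff_disj)
        have le: "r n (J n x) \<le> u + 1 / (real n + 1)" for n
          using upper[of n] u by (auto simp: r_def min_le_iff_disj add_increasing2)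
        have "(\<lambda>n. u + 1 / (real n + 1)) \<longlonglongrightarrow> u"
          using tendsto_add[OF tendsto_const[of u] LIMSEQ_inverse_real_of_nat]
          by (simp add: inverse_eq_divide add.commute)
        then have "(\<lambda>n. r n (J n x)) \<longlonglongrightarrow> u"
          by (rule tendsto_sandwich[of "\<lambda>_. u", rotated 3]) (auto intro!: always_eventually le less_imp_le[OF gt])
        then have "filterlim (\<lambda>n. r n (J n x)) (at_right u) sequentially"
          using gt by (auto simp: filterlim_at intro!: always_eventually)
        moreover have "\<forall>\<^sub>F s in at_right u. X s \<omega> = X u \<omega>"
          using chain \<omega> u \<open>u < T\<close> by (auto simp: markov_chain_def)
        ultimately have "\<forall>\<^sub>F n in sequentially. X (r n (J n x)) \<omega> = X u \<omega>"
          unfolding filterlim_iff by blast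
        then show ?thesis
          by (intro tendsto_eventually) (auto simp: K_def x elim: eventually_mono)
      qed
    qed
  qed
qed

lemma markov_chain_expectation:
  assumes S: "finite S" "\<xi> \<in> S" and chain: "markov_chain S T L t \<xi> M X" and t: "0 \<le> t" "t \<le> T"
    and f: "\<And>\<eta>. \<eta> \<in> S \<Longrightarrow> continuous_on {t..T} (\<lambda>u. f u \<eta>)"
  obtains p where "transition_function S T p" "has_generator S T p L"
    "(\<integral>\<omega>. ((LINT u:{t..T}|lborel. f u (X u \<omega>)) + g (X T \<omega>)) \<partial>M)
      = (LINT u:{t..T}|lborel. \<Sum>\<eta>\<in>S. p t u \<xi> \<eta> * f u \<eta>) + (\<Sum>\<eta>\<in>S. p t T \<xi> \<eta> * g \<eta>)"
proof -
  obtain p where p: "transition_function S T p" "has_generator S T p L"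
    and marg: "\<And>u \<eta>. u \<in> {t..T} \<Longrightarrow> \<eta> \<in> S \<Longrightarrow> measure M {\<omega> \<in> space M. X u \<omega> = \<eta>} = p t u \<xi> \<eta>"
    using markov_chain_marginal[OF S chain t] by blast
  interpret prob_space M using chain by (simp add: markov_chain_def)
  have sf_M: "sigma_finite_measure M" ..
  interpret pair_sigma_finite lborel M ..
  have X: "X u \<in> measurable M (count_space S)" if "u \<in> {t..T}" for u
    using chain that by (auto simp: markov_chain_def)
  have XS: "X u \<omega> \<in> S" if "u \<in> {t..T}" "\<omega> \<in> space M" for u \<omega>
    using measurable_space[OF X] that by auto
  have ev: "{\<omega> \<in> space M. X u \<omega> = \<eta>} \<in> sets M" if "u \<in> {t..T}" "\<eta> \<in> S" for u \<eta>
    using measurable_sets[OF X[OF that(1)], of "{\<eta>}"] that by (simp add: vimage_def Int_def conj_commute)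
  define I where "I \<eta> u \<omega> = (if u \<in> {t..T} \<and> X u \<omega> = \<eta> then 1 else 0 :: real)" for \<eta> u \<omega>
  \<comment> \<open>Expanding over the finitely many states separates the deterministic factors from
    indicators already known to be jointly measurable, as Fubini requires.\<close>
  define \<Phi> where "\<Phi> u \<omega> = (\<Sum>\<eta>\<in>S. (indicator {t..T} u *\<^sub>R f u \<eta>) * I \<eta> u \<omega>)" for u \<omega>
  have \<Phi>: "\<Phi> u \<omega> = indicator {t..T} u *\<^sub>R f u (X u \<omega>)" if "\<omega> \<in> space M" for u \<omega>
  proof (cases "u \<in> {t..T}")
    case True
    have "\<Phi> u \<omega> = (\<Sum>\<eta>\<in>S. if \<eta> = X u \<omega> then f u \<eta> else 0)"
      using True unfolding \<Phi>_def by (intro sum.cong) (auto simp: I_def)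
    with XS[OF True that] S True show ?thesis by simp
  qed (simp add: \<Phi>_def)
  have intE: "(\<integral>\<omega>. I \<eta> u \<omega> \<partial>M) = p t u \<xi> \<eta>" "integrable M (I \<eta> u)"
    if "u \<in> {t..T}" "\<eta> \<in> S" for u \<eta>
  proof -
    have ind: "I \<eta> u \<omega> = indicator {\<omega> \<in> space M. X u \<omega> = \<eta>} \<omega>" if "\<omega> \<in> space M" for \<omega>
      using \<open>u \<in> _\<close> that by (simp add: I_def)
    show "(\<integral>\<omega>. I \<eta> u \<omega> \<partial>M) = p t u \<xi> \<eta>"
      using ev[OF that] marg[OF that] by (subst Bochner_Integration.integral_cong[OF refl ind]) auto
    show "integrable M (I \<eta> u)"
      using ev[OF that] by (subst Bochner_Integration.integrable_cong[OF refl ind]) (auto simp: emeasure_eq_measure)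
  qed
  have "integrable (lborel \<Otimes>\<^sub>M M) (\<lambda>x. (indicator {t..T} (fst x) *\<^sub>R f (fst x) \<eta>) * I \<eta> (fst x) (snd x))"
    if \<eta>: "\<eta> \<in> S" for \<eta>
  proof -
    have I: "(\<lambda>x. I \<eta> (fst x) (snd x)) \<in> borel_measurable (lborel \<Otimes>\<^sub>M M)"
      unfolding I_def by (rule markov_chain_measurable[OF chain \<eta>])
    have "(\<lambda>u. indicator {t..T} u *\<^sub>R f u \<eta>) \<in> borel_measurable borel"
      by (rule borel_measurable_continuous_on_indicator[OF _ f[OF \<eta>]]) simp
    then have F: "(\<lambda>x. indicator {t..T} (fst x) *\<^sub>R f (fst x) \<eta>) \<in> borel_measurable (lborel \<Otimes>\<^sub>M M)"
      by (intro measurable_compose[OF measurable_fst]) simp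
    obtain B where B: "\<And>u. u \<in> {t..T} \<Longrightarrow> norm (f u \<eta>) \<le> B"
      using compact_imp_bounded[OF compact_continuous_image[OF f[OF \<eta>] compact_Icc]]
      unfolding bounded_iff by (meson imageI)
    show ?thesis
    proof (rule integrableI_bounded_set[where A = "{t..T} \<times> space M" and B = B])
      show "emeasure (lborel \<Otimes>\<^sub>M M) ({t..T} \<times> space M) < \<infinity>"
        using t sigma_finite_measure.emeasure_pair_measure_Times[OF sf_M,
            where A = "{t..T}" and N = lborel and B = "space M"]
        by (simp add: emeasure_space_1)
      have "0 \<le> B" using B[of t] t by (auto intro: order_trans[OF norm_ge_zero])
      then show "AE x in lborel \<Otimes>\<^sub>M M. x \<in> {t..T} \<times> space M \<longrightarrow>
          norm (indicator {t..T} (fst x) *\<^sub>R f (fst x) \<eta> * I \<eta> (fst x) (snd x)) \<le> B"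
        using B by (intro AE_I2) (auto simp: I_def)
      show "AE x in lborel \<Otimes>\<^sub>M M. x \<notin> {t..T} \<times> space M \<longrightarrow>
          indicator {t..T} (fst x) *\<^sub>R f (fst x) \<eta> * I \<eta> (fst x) (snd x) = 0"
        by (intro AE_I2) (auto simp: space_pair_measure I_def)
    qed (use F I in simp_all)
  qed
  then have int\<Phi>: "integrable (lborel \<Otimes>\<^sub>M M) (\<lambda>(u, \<omega>). \<Phi> u \<omega>)"
    unfolding \<Phi>_def case_prod_unfold by (intro Bochner_Integration.integrable_sum)
  have "(\<integral>\<omega>. (LINT u:{t..T}|lborel. f u (X u \<omega>)) \<partial>M) = (\<integral>\<omega>. (\<integral>u. \<Phi> u \<omega> \<partial>lborel) \<partial>M)"
    by (intro Bochner_Integration.integral_cong) (auto simp: set_lebesgue_integral_def \<Phi>)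
  also have "\<dots> = (\<integral>u. (\<integral>\<omega>. \<Phi> u \<omega> \<partial>M) \<partial>lborel)"
    by (rule Fubini_integral[OF int\<Phi>])
  also have "\<dots> = (LINT u:{t..T}|lborel. \<Sum>\<eta>\<in>S. p t u \<xi> \<eta> * f u \<eta>)"
    unfolding set_lebesgue_integral_def
  proof (intro Bochner_Integration.integral_cong refl)
    fix u
    show "(\<integral>\<omega>. \<Phi> u \<omega> \<partial>M) = indicator {t..T} u *\<^sub>R (\<Sum>\<eta>\<in>S. p t u \<xi> \<eta> * f u \<eta>)"
    proof (cases "u \<in> {t..T}")
      case True
      then show ?thesis
        unfolding \<Phi>_def
        by (subst Bochner_Integration.integral_sum) (auto simp: intE mult.commute intro!: integrable_mult_right)
    qed (simp add: \<Phi>_def)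
  qed
  finally have run: "(\<integral>\<omega>. (LINT u:{t..T}|lborel. f u (X u \<omega>)) \<partial>M)
      = (LINT u:{t..T}|lborel. \<Sum>\<eta>\<in>S. p t u \<xi> \<eta> * f u \<eta>)" .
  have "integrable M (\<lambda>\<omega>. \<integral>u. \<Phi> u \<omega> \<partial>lborel)"
    using integrable_snd[OF int\<Phi>] .
  then have int_run: "integrable M (\<lambda>\<omega>. LINT u:{t..T}|lborel. f u (X u \<omega>))"
    by (rule Bochner_Integration.integrable_cong[THEN iffD1, rotated -1])
       (auto simp: set_lebesgue_integral_def \<Phi>)
  have g: "g (X T \<omega>) = (\<Sum>\<eta>\<in>S. g \<eta> * I \<eta> T \<omega>)" if "\<omega> \<in> space M" for \<omega>
  proof -
    have "(\<Sum>\<eta>\<in>S. g \<eta> * I \<eta> T \<omega>) = (\<Sum>\<eta>\<in>S. if \<eta> = X T \<omega> then g \<eta> else 0)"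
      using t by (intro sum.cong) (auto simp: I_def)
    with XS[of T \<omega>] that t S show ?thesis by simp
  qed
  have int_g: "integrable M (\<lambda>\<omega>. \<Sum>\<eta>\<in>S. g \<eta> * I \<eta> T \<omega>)"
    using t intE by (intro Bochner_Integration.integrable_sum integrable_mult_right) auto
  have "(\<integral>\<omega>. g (X T \<omega>) \<partial>M) = (\<Sum>\<eta>\<in>S. p t T \<xi> \<eta> * g \<eta>)"
    using t intE
    by (subst Bochner_Integration.integral_cong[OF refl g], simp,
        subst Bochner_Integration.integral_sum) (auto simp: mult.commute)
  moreover have "integrable M (\<lambda>\<omega>. g (X T \<omega>))"
    using int_g by (rule Bochner_Integration.integrable_cong[THEN iffD2, rotated -1]) (auto simp: g)
  ultimately show thesis
    using int_run run by (intro that[OF p]) (subst Bochner_Integration.integral_add, auto)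
qed

text \<open>
  Dynkin's formula turns the sign of \<open>w' + L w + f\<close> into monotonicity of
  \<open>E w(u, X\<^sub>u) + E \<integral>\<^sub>t\<^sup>u f\<close>; no regularity of \<open>w'\<close> in time is needed.
\<close>

lemma markov_chain_comparison:
  fixes g :: "'s \<Rightarrow> real"
  assumes S: "finite S" "\<xi> \<in> S" and chain: "markov_chain S T L t \<xi> M X" and t: "0 \<le> t" "t \<le> T"
    and f: "\<And>\<eta>. \<eta> \<in> S \<Longrightarrow> continuous_on {0..T} (\<lambda>u. f u \<eta>)"
    and w: "\<And>u \<eta>. u \<in> {0..T} \<Longrightarrow> \<eta> \<in> S \<Longrightarrow> ((\<lambda>u. w u \<eta>) has_real_derivative w' u \<eta>) (at u within {0..T})"
  defines "J \<equiv> (\<integral>\<omega>. ((LINT u:{t..T}|lborel. f u (X u \<omega>)) + g (X T \<omega>)) \<partial>M)"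
  shows subsolution_le: "(\<And>\<eta>. \<eta> \<in> S \<Longrightarrow> w T \<eta> \<le> g \<eta>) \<Longrightarrow>
      (\<And>u \<eta>. u \<in> {0..T} \<Longrightarrow> \<eta> \<in> S \<Longrightarrow> 0 \<le> w' u \<eta> + L (w u) u \<eta> + f u \<eta>) \<Longrightarrow> w t \<xi> \<le> J"
    and supersolution_ge: "(\<And>\<eta>. \<eta> \<in> S \<Longrightarrow> g \<eta> \<le> w T \<eta>) \<Longrightarrow>
      (\<And>u \<eta>. u \<in> {0..T} \<Longrightarrow> \<eta> \<in> S \<Longrightarrow> w' u \<eta> + L (w u) u \<eta> + f u \<eta> \<le> 0) \<Longrightarrow> J \<le> w t \<xi>"
proof -
  have f': "continuous_on {t..T} (\<lambda>u. f u \<eta>)" if "\<eta> \<in> S" for \<eta>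
    using f[OF that] by (rule continuous_on_subset) (use t in auto)
  obtain p where p: "transition_function S T p" "has_generator S T p L"
    and J: "J = (LINT u:{t..T}|lborel. \<Sum>\<eta>\<in>S. p t u \<xi> \<eta> * f u \<eta>) + (\<Sum>\<eta>\<in>S. p t T \<xi> \<eta> * g \<eta>)"
    unfolding J_def using markov_chain_expectation[OF S chain t, of f g] f' by blast
  have p0: "0 \<le> p t u \<xi> \<eta>" if "u \<in> {t..T}" "\<eta> \<in> S" for u \<eta>
    using p(1) that t S by (auto simp: transition_function_def)
  have pt: "p t t \<xi> \<eta> = (if \<xi> = \<eta> then 1 else 0)" if "\<eta> \<in> S" for \<eta>
    using p(1) that t S by (auto simp: transition_function_def)
  have contp: "continuous_on {t..T} (\<lambda>u. p t u \<xi> \<eta>)" if "\<eta> \<in> S" for \<eta>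
  proof (rule DERIV_continuous_on)
    fix u assume "u \<in> {t..T}"
    then show "((\<lambda>u. p t u \<xi> \<eta>) has_real_derivative
        (\<Sum>\<zeta>\<in>S. p t u \<xi> \<zeta> * L (\<lambda>\<zeta>. if \<zeta> = \<eta> then 1 else 0) u \<zeta>)) (at u within {t..T})"
      using kolmogorov_forward[OF S(1) p t(1), of u \<xi> "\<lambda>\<zeta>. if \<zeta> = \<eta> then 1 else 0"] that S
      by (auto simp: if_distrib[of "\<lambda>x. _ * x"] sum.delta' cong: if_cong)
  qed
  define q where "q u = (\<Sum>\<eta>\<in>S. p t u \<xi> \<eta> * f u \<eta>)" for u
  have q: "continuous_on {t..T} q"
    unfolding q_def by (intro continuous_on_sum continuous_on_mult contp f')
  \<comment> \<open>At \<open>u = t\<close> this is \<open>w t \<xi>\<close>; at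
    \<open>u = T\<close> it differs from \<open>J\<close> only through the mismatch of
    \<open>w T\<close> and \<open>g\<close>.\<close>
  define \<Psi> where "\<Psi> u = (\<Sum>\<eta>\<in>S. p t u \<xi> \<eta> * w u \<eta>) + integral {t..u} q" for u
  have \<Psi>: "(\<Psi> has_real_derivative (\<Sum>\<eta>\<in>S. p t u \<xi> \<eta> * (w' u \<eta> + L (w u) u \<eta> + f u \<eta>))) (at u within {t..T})"
    if u: "u \<in> {t..T}" for u
  proof -
    have "((\<lambda>y. \<Sum>\<eta>\<in>S. p t y \<xi> \<eta> * w y \<eta>) has_real_derivative
           (\<Sum>\<eta>\<in>S. p t u \<xi> \<eta> * (w' u \<eta> + L (w u) u \<eta>))) (at u within {t..T})"
      using u t by (intro dynkin[OF S(1) p t(1)] w S) auto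
    from DERIV_add[OF this integral_has_real_derivative[OF q u]]
    show ?thesis
      by (simp add: \<Psi>_def[abs_def] q_def sum.distrib distrib_left)
  qed
  have \<Psi>': "(\<Psi> has_real_derivative (\<Sum>\<eta>\<in>S. p t u \<xi> \<eta> * (w' u \<eta> + L (w u) u \<eta> + f u \<eta>))) (at u)"
    if "t < u" "u < T" for u
    using \<Psi>[of u] that at_within_Icc_at[OF that] by simp
  have cont: "continuous_on {t..T} \<Psi>"
    using \<Psi> by (rule DERIV_continuous_on)
  have start: "\<Psi> t = w t \<xi>"
  proof -
    have "(\<Sum>\<eta>\<in>S. p t t \<xi> \<eta> * w t \<eta>) = (\<Sum>\<eta>\<in>S. if \<xi> = \<eta> then w t \<eta> else 0)"
      by (intro sum.cong) (auto simp: pt)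
    then show ?thesis
      using S by (simp add: \<Psi>_def)
  qed
  have "(LINT u:{t..T}|lborel. q u) = integral {t..T} q"
    by (intro set_borel_integral_eq_integral borel_integrable_atLeastAtMost' q)
  then have J': "J = integral {t..T} q + (\<Sum>\<eta>\<in>S. p t T \<xi> \<eta> * g \<eta>)"
    by (simp add: J q_def)
  {
    assume g: "\<And>\<eta>. \<eta> \<in> S \<Longrightarrow> w T \<eta> \<le> g \<eta>"
      and pos: "\<And>u \<eta>. u \<in> {0..T} \<Longrightarrow> \<eta> \<in> S \<Longrightarrow> 0 \<le> w' u \<eta> + L (w u) u \<eta> + f u \<eta>"
    have "\<Psi> t \<le> \<Psi> T"
    proof (rule DERIV_nonneg_imp_increasing_open[OF t(2) _ cont])
      fix u assume u: "t < u" "u < T"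
      have "0 \<le> (\<Sum>\<eta>\<in>S. p t u \<xi> \<eta> * (w' u \<eta> + L (w u) u \<eta> + f u \<eta>))"
        by (intro sum_nonneg mult_nonneg_nonneg p0 pos) (use u t in auto)
      with \<Psi>'[OF u] show "\<exists>y. DERIV \<Psi> u :> y \<and> 0 \<le> y"
        by blast
    qed
    also have "\<Psi> T \<le> J"
      unfolding \<Psi>_def J' using p0 g t by (auto intro!: sum_mono mult_left_mono)
    finally show "w t \<xi> \<le> J" by (simp add: start)
  next
    assume g: "\<And>\<eta>. \<eta> \<in> S \<Longrightarrow> g \<eta> \<le> w T \<eta>"
      and neg: "\<And>u \<eta>. u \<in> {0..T} \<Longrightarrow> \<eta> \<in> S \<Longrightarrow> w' u \<eta> + L (w u) u \<eta> + f u \<eta> \<le> 0"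
    have "J \<le> \<Psi> T"
      unfolding \<Psi>_def J' using p0 g t by (auto intro!: sum_mono mult_left_mono)
    also have "\<Psi> T \<le> \<Psi> t"
    proof (rule DERIV_nonpos_imp_decreasing_open[OF t(2) _ cont])
      fix u assume u: "t < u" "u < T"
      have "(\<Sum>\<eta>\<in>S. p t u \<xi> \<eta> * (w' u \<eta> + L (w u) u \<eta> + f u \<eta>)) \<le> 0"
        by (intro sum_nonpos mult_nonneg_nonpos p0 neg) (use u t in auto)
      with \<Psi>'[OF u] show "\<exists>y. DERIV \<Psi> u :> y \<and> y \<le> 0"
        by blast
    qed
    finally show "J \<le> w t \<xi>" by (simp add: start)
  }
qed

section \<open>Strongly convex Hamiltonians\<close>

text \<open>For a Euclidean norm and convex \<open>K\<close> this says that \<open>f\<close> minus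
  \<open>\<gamma>\<close> times the squared norm is convex, so \<open>\<gamma>\<close> is half of
  the usual modulus.\<close>

definition strongly_convex_on :: "real \<Rightarrow> 'a::real_normed_vector set \<Rightarrow> ('a \<Rightarrow> real) \<Rightarrow> bool" where
  "strongly_convex_on \<gamma> K f \<longleftrightarrow> (\<forall>a\<in>K. \<forall>a'\<in>K. \<forall>\<tau>\<in>{0..1}.
     \<tau> * f a' + (1 - \<tau>) * f a - f (\<tau> *\<^sub>R a' + (1 - \<tau>) *\<^sub>R a) \<ge> \<gamma> * \<tau> * (1 - \<tau>) * (norm (a' - a))\<^sup>2)"

lemma strongly_convex_on_midpoint:
  assumes "strongly_convex_on \<gamma> K f" "a \<in> K" "b \<in> K"
  shows "f ((1/2) *\<^sub>R a + (1/2) *\<^sub>R b) + \<gamma> / 4 * (norm (a - b))\<^sup>2 \<le> (f a + f b) / 2"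
proof -
  have "\<gamma> * (1/2) * (1 - 1/2) * (norm (a - b))\<^sup>2
      \<le> (1/2) * f a + (1 - 1/2) * f b - f ((1/2) *\<^sub>R a + (1 - 1/2) *\<^sub>R b)"
    using assms unfolding strongly_convex_on_def by (elim ballE[where x = "1/2"] ballE) auto
  then show ?thesis by (simp add: field_simps)
qed

lemma strongly_convex_on_subset:
  "strongly_convex_on \<gamma> K f \<Longrightarrow> K' \<subseteq> K \<Longrightarrow> strongly_convex_on \<gamma> K' f"
  unfolding strongly_convex_on_def by blast

text \<open>The minimum is compared with the value at the midpoint of \<open>a\<close> and
  \<open>b\<close>. Points closer to \<open>a\<close> would improve \<open>\<gamma> / 2\<close> to
  \<open>\<gamma>\<close>, but the midpoint avoids a limit.\<close>

lemma strongly_convex_on_arg_min_growth: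
  assumes f: "strongly_convex_on \<gamma> K f" and K: "convex K"
    and a: "is_arg_min f (\<lambda>a. a \<in> K) a" and b: "b \<in> K"
  shows "f a + \<gamma> / 2 * (norm (b - a))\<^sup>2 \<le> f b"
proof -
  have "a \<in> K" using a by (simp add: is_arg_min_def)
  with K b have "(1/2) *\<^sub>R b + (1/2) *\<^sub>R a \<in> K"
    by (auto intro: convexD)
  with a have "f a \<le> f ((1/2) *\<^sub>R b + (1/2) *\<^sub>R a)"
    by (auto simp: is_arg_min_linorder)
  with strongly_convex_on_midpoint[OF f b \<open>a \<in> K\<close>] show ?thesis
    by (simp add: field_simps)
qed

lemma strongly_convex_on_arg_min_unique:
  assumes f: "strongly_convex_on \<gamma> K f" "0 < \<gamma>" and K: "convex K"
    and ab: "is_arg_min f (\<lambda>a. a \<in> K) a" "is_arg_min f (\<lambda>a. a \<in> K) b"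
  shows "a = b"
proof -
  have "f a = f b"
    using ab by (auto simp: is_arg_min_linorder intro: order_antisym)
  moreover have "f a + \<gamma> / 2 * (norm (b - a))\<^sup>2 \<le> f b"
    using ab by (intro strongly_convex_on_arg_min_growth[OF f(1) K]) (auto simp: is_arg_min_def)
  ultimately have "(norm (b - a))\<^sup>2 \<le> 0"
    using f(2) by (simp add: mult_le_0_iff)
  then show ?thesis by simp
qed

text \<open>Adding the growth inequality of \<open>f\<close> at \<open>b\<close> to that of
  \<open>h\<close> at \<open>a\<close> leaves only the variation of \<open>f - h\<close> between the
  two minimisers, so anything in \<open>f - h\<close> that is constant on \<open>K\<close>
  cancels.\<close>

lemma strongly_convex_on_arg_min_dist:
  assumes f: "strongly_convex_on \<gamma> K f" and h: "strongly_convex_on \<gamma> K h" and "0 < \<gamma>" and K: "convex K"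
    and a: "is_arg_min f (\<lambda>a. a \<in> K) a" and b: "is_arg_min h (\<lambda>a. a \<in> K) b"
    and "(f b - h b) - (f a - h a) \<le> c * norm (b - a)" and "0 \<le> c"
  shows "norm (b - a) \<le> c / \<gamma>"
proof (cases "a = b")
  case True
  then show ?thesis using \<open>0 < \<gamma>\<close> \<open>0 \<le> c\<close> by simp
next
  case False
  have "f a + \<gamma> / 2 * (norm (b - a))\<^sup>2 \<le> f b"
    using a b by (intro strongly_convex_on_arg_min_growth[OF f K]) (auto simp: is_arg_min_def)
  moreover have "h b + \<gamma> / 2 * (norm (a - b))\<^sup>2 \<le> h a"
    using a b by (intro strongly_convex_on_arg_min_growth[OF h K]) (auto simp: is_arg_min_def)
  ultimately have "\<gamma> * (norm (b - a))\<^sup>2 \<le> c * norm (b - a)"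
    using assms(7) by (simp add: norm_minus_commute)
  with False have "\<gamma> * norm (b - a) \<le> c"
    by (simp add: power2_eq_square)
  then show ?thesis using \<open>0 < \<gamma>\<close> by (simp add: field_simps)
qed

section \<open>The finite state space and the sets of rates\<close>

lemma finite_grid: "finite (grid G)"
proof -
  define A where "A = (\<lambda>k. real k / real (pop G)) ` {..pop G}"
  have "vec_nth ` grid G \<subseteq> PiE UNIV (\<lambda>_. A)"
    by (auto simp: grid_def A_def)
  moreover have "finite (PiE (UNIV :: 'a set) (\<lambda>_. A))"
    by (intro finite_PiE) (auto simp: A_def)
  ultimately have "finite (vec_nth ` grid G)"
    by (rule finite_subset)
  then show ?thesis
    by (rule finite_imageD) (auto intro: inj_onI simp: vec_eq_iff)
qed

lemma finite_states: "finite (states G)"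
  by (simp add: states_def finite_grid)

lemma shift_in_grid:
  assumes \<mu>: "\<mu> \<in> grid G" and "0 < pop G" and z: "\<mu> $ z \<noteq> 0"
  shows "\<mu> + shift G y z \<in> grid G"
proof (cases "y = z")
  case True
  then show ?thesis using \<mu> by (simp add: shift_def)
next
  case False
  let ?N = "real (pop G)"
  have N: "0 < ?N" using assms by simp
  have sum1: "(\<Sum>i\<in>UNIV. \<mu> $ i) = 1" and
    ex: "\<And>i. \<exists>k\<le>pop G. \<mu> $ i = real k / ?N"
    using \<mu> by (auto simp: grid_def)
  have nonneg: "0 \<le> \<mu> $ i" for i
    using ex[of i] by auto
  have comp: "(\<mu> + shift G y z) $ i = \<mu> $ i + (if i = y then 1 / ?N else 0) - (if i = z then 1 / ?N else 0)" for i
    by (auto simp: shift_def axis_def)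
  obtain kz where kz: "kz \<le> pop G" "\<mu> $ z = real kz / ?N" using ex by blast
  with z have "0 < kz" by (cases kz) auto
  \<comment> \<open>This leaves room for the gain at \<open>y\<close>: the entry at \<open>z\<close>
    is at least \<open>1 / N\<close>, so the entry at \<open>y\<close> is at most
    \<open>1 - 1 / N\<close>.\<close>
  have "\<mu> $ y + \<mu> $ z \<le> 1"
    using sum1 False sum_mono2[of UNIV "{y, z}" "\<lambda>i. \<mu> $ i"] nonneg by simp
  have "\<exists>k\<le>pop G. (\<mu> + shift G y z) $ i = real k / ?N" for i
  proof -
    consider "i = y" | "i = z" | "i \<noteq> y" "i \<noteq> z" by blast
    then show ?thesis
    proof cases
      case 1
      obtain k where k: "k \<le> pop G" "\<mu> $ y = real k / ?N" using ex by blast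
      have "real k + real kz \<le> ?N"
        using \<open>\<mu> $ y + \<mu> $ z \<le> 1\<close> k kz N by (simp add: field_simps)
      then have "Suc k \<le> pop G" using \<open>0 < kz\<close> by linarith
      moreover have "(\<mu> + shift G y z) $ i = real (Suc k) / ?N"
        unfolding comp using 1 False k by (simp add: add_divide_distrib)
      ultimately show ?thesis by blast
    next
      case 2
      have "(\<mu> + shift G y z) $ i = real (kz - 1) / ?N"
        unfolding comp using 2 False kz \<open>0 < kz\<close> by (simp add: diff_divide_distrib of_nat_diff)
      moreover have "kz - 1 \<le> pop G" using kz by simp
      ultimately show ?thesis by blast
    next
      case 3
      then show ?thesis unfolding comp using ex[of i] by simp
    qed
  qed
  moreover have "(\<Sum>i\<in>UNIV. (\<mu> + shift G y z) $ i) = 1"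
    by (simp only: comp sum_subtractf sum.distrib) (simp add: sum1)
  ultimately show ?thesis by (simp add: grid_def)
qed

lemma zero_in_rates [simp]: "0 \<in> rates x"
  by (simp add: rates_def)

lemma convex_rates: "convex (rates x)"
  by (auto simp: rates_def convex_def)

lemma closed_rates: "closed (rates x)"
proof -
  have "rates x = {a. a $ x = 0} \<inter> (\<Inter>y. {a. 0 \<le> a $ y})"
    by (auto simp: rates_def)
  moreover have "closed \<dots>"
    by (intro closed_Int closed_INT ballI closed_Collect_eq closed_Collect_le continuous_intros)
  ultimately show ?thesis by simp
qed

lemma sum_triple_le_norm:
  fixes r a p :: "real ^ 'd::finite"
  shows "\<bar>\<Sum>y\<in>A. r $ y * a $ y * p $ y\<bar> \<le> real CARD('d) * norm r * norm a * norm p"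
proof -
  have "\<bar>\<Sum>y\<in>A. r $ y * a $ y * p $ y\<bar> \<le> (\<Sum>y\<in>A. \<bar>r $ y * a $ y * p $ y\<bar>)"
    by (rule sum_abs)
  also have "\<dots> \<le> (\<Sum>y\<in>UNIV. \<bar>r $ y * a $ y * p $ y\<bar>)"
    by (intro sum_mono2) auto
  also have "\<dots> \<le> (\<Sum>y\<in>(UNIV::'d set). norm r * norm a * norm p)"
    unfolding abs_mult by (intro sum_mono mult_mono component_le_norm_cart mult_nonneg_nonneg) auto
  finally show ?thesis by simp
qed

lemma sum_pair_le_norm:
  fixes r p :: "real ^ 'd::finite"
  shows "\<bar>\<Sum>y\<in>A. r $ y * p $ y\<bar> \<le> real CARD('d) * norm r * norm p"
proof -
  have "\<bar>\<Sum>y\<in>A. r $ y * p $ y\<bar> \<le> (\<Sum>y\<in>A. \<bar>r $ y * p $ y\<bar>)"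
    by (rule sum_abs)
  also have "\<dots> \<le> (\<Sum>y\<in>UNIV. \<bar>r $ y * p $ y\<bar>)"
    by (intro sum_mono2) auto
  also have "\<dots> \<le> (\<Sum>y\<in>(UNIV::'d set). norm r * norm p)"
    unfolding abs_mult by (intro sum_mono mult_mono component_le_norm_cart) auto
  finally show ?thesis by simp
qed

lemma pre_hamiltonian_alt:
  "pre_hamiltonian G \<xi> p a = run_cost G \<xi> a + (\<Sum>y\<in>UNIV - {fst \<xi>}. rate0 G \<xi> $ y * p $ y)
     + (\<Sum>y\<in>UNIV - {fst \<xi>}. rate1 G \<xi> $ y * a $ y * p $ y)"
  by (simp add: pre_hamiltonian_def distrib_right sum.distrib)

text \<open>The constraint set is a parameter so that the truncated problem, needed for existence,
  and the original one share their estimates.\<close>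

definition opt_in :: "(real ^ 'd) set \<Rightarrow> 'd::finite game \<Rightarrow> 'd state \<Rightarrow> real ^ 'd \<Rightarrow> real ^ 'd" where
  "opt_in K G \<xi> p = (THE a. is_arg_min (pre_hamiltonian G \<xi> p) (\<lambda>a. a \<in> K) a)"

lemma opt_rate_eq_opt_in: "opt_rate G \<xi> = opt_in (rates (fst \<xi>)) G \<xi>"
  by (simp add: opt_rate_def opt_in_def fun_eq_iff)

text \<open>The running cost may be unbounded in the rate, so \<open>\<Lambda>\<close> bounds it at
  rate 0 only; this controls both the size of minimisers and the cost of the zero control.\<close>

locale strongly_convex_game =
  fixes G :: "'d::finite game" and \<gamma> \<Lambda> :: real
  assumes pop_pos: "0 < pop G" and horizon_pos: "0 < horizon G" and gamma_pos: "0 < \<gamma>"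
    and run_cost_convex: "\<xi> \<in> states G \<Longrightarrow> strongly_convex_on \<gamma> (rates (fst \<xi>)) (run_cost G \<xi>)"
    and run_cost_cont: "\<xi> \<in> states G \<Longrightarrow> continuous_on (rates (fst \<xi>)) (run_cost G \<xi>)"
    and run_cost_nonneg: "\<xi> \<in> states G \<Longrightarrow> a \<in> rates (fst \<xi>) \<Longrightarrow> 0 \<le> run_cost G \<xi> a"
    and term_cost_nonneg: "\<xi> \<in> states G \<Longrightarrow> 0 \<le> term_cost G \<xi>"
    and rate0_bound: "\<xi> \<in> states G \<Longrightarrow> norm (rate0 G \<xi>) \<le> \<Lambda>"
    and rate1_bound: "\<xi> \<in> states G \<Longrightarrow> norm (rate1 G \<xi>) \<le> \<Lambda>"
    and run_cost_0: "\<xi> \<in> states G \<Longrightarrow> run_cost G \<xi> 0 \<le> \<Lambda>"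
    and term_cost_bound: "\<xi> \<in> states G \<Longrightarrow> term_cost G \<xi> \<le> \<Lambda>"
    and Lambda_nonneg: "0 \<le> \<Lambda>"

lemma standing_assumptions_imp_game:
  assumes "standing_assumptions G"
  obtains \<gamma> \<Lambda> where "strongly_convex_game G \<gamma> \<Lambda>"
proof -
  let ?f = "\<lambda>\<xi>. norm (rate0 G \<xi>) + norm (rate1 G \<xi>) + \<bar>run_cost G \<xi> 0\<bar> + \<bar>term_cost G \<xi>\<bar>"
  define \<Lambda> where "\<Lambda> = (\<Sum>\<xi>\<in>states G. ?f \<xi>)"
  have bound: "?f \<xi> \<le> \<Lambda>" if "\<xi> \<in> states G" for \<xi>
    unfolding \<Lambda>_def using that finite_states by (intro member_le_sum[of \<xi> _ ?f]) auto
  obtain \<gamma> where "0 < \<gamma>" and \<gamma>: "\<forall>\<xi>\<in>states G. strongly_convex_on \<gamma> (rates (fst \<xi>)) (run_cost G \<xi>)"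
    using assms unfolding standing_assumptions_def strongly_convex_on_def by blast
  show thesis
  proof (rule that, unfold_locales)
    show "0 \<le> \<Lambda>" unfolding \<Lambda>_def by (intro sum_nonneg) auto
    fix \<xi> assume \<xi>: "\<xi> \<in> states G"
    note b = bound[OF \<xi>] norm_ge_zero[of "rate0 G \<xi>"] norm_ge_zero[of "rate1 G \<xi>"]
    show "norm (rate0 G \<xi>) \<le> \<Lambda>" using b by linarith
    show "norm (rate1 G \<xi>) \<le> \<Lambda>" using b by linarith
    show "run_cost G \<xi> 0 \<le> \<Lambda>" using b by linarith
    show "term_cost G \<xi> \<le> \<Lambda>" using b by linarith
  qed (use assms \<open>0 < \<gamma>\<close> \<gamma> in \<open>auto simp: standing_assumptions_def\<close>)
qed

section \<open>The pre-Hamiltonian, its minimisers and the Hamiltonian\<close>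

context strongly_convex_game
begin

definition C where "C = real CARD('d) * \<Lambda>"

lemma C_nonneg: "0 \<le> C"
  using Lambda_nonneg by (simp add: C_def)

lemma rate0_sum_le:
  assumes "\<xi> \<in> states G"
  shows "\<bar>\<Sum>y\<in>A. rate0 G \<xi> $ y * p $ y\<bar> \<le> C * norm p"
  by (rule order_trans[OF sum_pair_le_norm])
     (use rate0_bound[OF assms] Lambda_nonneg in \<open>auto simp: C_def intro!: mult_mono\<close>)

lemma rate1_sum_le:
  assumes "\<xi> \<in> states G"
  shows "\<bar>\<Sum>y\<in>A. rate1 G \<xi> $ y * a $ y * p $ y\<bar> \<le> C * norm a * norm p"
  by (rule order_trans[OF sum_triple_le_norm])
     (use rate1_bound[OF assms] Lambda_nonneg in \<open>auto simp: C_def intro!: mult_mono\<close>)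

lemma pre_hamiltonian_convex:
  assumes \<xi>: "\<xi> \<in> states G" and K: "K \<subseteq> rates (fst \<xi>)"
  shows "strongly_convex_on \<gamma> K (pre_hamiltonian G \<xi> p)"
proof -
  have lin: "(\<Sum>y\<in>A. rate1 G \<xi> $ y * (\<tau> *\<^sub>R a' + (1 - \<tau>) *\<^sub>R a) $ y * p $ y)
      = \<tau> * (\<Sum>y\<in>A. rate1 G \<xi> $ y * a' $ y * p $ y) + (1 - \<tau>) * (\<Sum>y\<in>A. rate1 G \<xi> $ y * a $ y * p $ y)"
    for A \<tau> a a'
    unfolding sum_distrib_left sum.distrib[symmetric] by (intro sum.cong) (auto simp: algebra_simps)
  have "strongly_convex_on \<gamma> (rates (fst \<xi>)) (pre_hamiltonian G \<xi> p)"
    using run_cost_convex[OF \<xi>] unfolding strongly_convex_on_def pre_hamiltonian_alt lin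
    by (simp add: algebra_simps)
  then show ?thesis
    using K by (rule strongly_convex_on_subset)
qed

lemma pre_hamiltonian_diff_le:
  assumes "\<xi> \<in> states G"
  shows "\<bar>pre_hamiltonian G \<xi> p a - pre_hamiltonian G \<xi> q a\<bar> \<le> C * (1 + norm a) * norm (p - q)"
proof -
  have "pre_hamiltonian G \<xi> p a - pre_hamiltonian G \<xi> q a =
      (\<Sum>y\<in>UNIV - {fst \<xi>}. rate0 G \<xi> $ y * (p - q) $ y)
      + (\<Sum>y\<in>UNIV - {fst \<xi>}. rate1 G \<xi> $ y * a $ y * (p - q) $ y)"
    by (simp add: pre_hamiltonian_alt right_diff_distrib sum_subtractf)
  moreover note rate0_sum_le[OF assms, where A = "UNIV - {fst \<xi>}" and p = "p - q"]
    rate1_sum_le[OF assms, where A = "UNIV - {fst \<xi>}" and a = a and p = "p - q"]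
  ultimately show ?thesis
    by (simp add: algebra_simps)
qed

text \<open>Running costs and uncontrolled rates cancel in the double difference. What remains is
  bilinear in \<open>b - a\<close> and \<open>p - q\<close>, so the bound is free of the sizes of
  \<open>a\<close> and \<open>b\<close>.\<close>

lemma pre_hamiltonian_diff_diff_le:
  assumes "\<xi> \<in> states G"
  shows "(pre_hamiltonian G \<xi> p b - pre_hamiltonian G \<xi> q b) - (pre_hamiltonian G \<xi> p a - pre_hamiltonian G \<xi> q a)
    \<le> C * norm (p - q) * norm (b - a)"
proof -
  have "(pre_hamiltonian G \<xi> p b - pre_hamiltonian G \<xi> q b) - (pre_hamiltonian G \<xi> p a - pre_hamiltonian G \<xi> q a)
      = (\<Sum>y\<in>UNIV - {fst \<xi>}. rate1 G \<xi> $ y * (b - a) $ y * (p - q) $ y)"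
    by (simp add: pre_hamiltonian_alt left_diff_distrib right_diff_distrib sum_subtractf)
  also have "\<dots> \<le> C * norm (b - a) * norm (p - q)"
    using rate1_sum_le[OF assms, where A = "UNIV - {fst \<xi>}" and a = "b - a" and p = "p - q"] by linarith
  finally show ?thesis by (simp add: mult.commute mult.left_commute)
qed

lemma pre_hamiltonian_cont:
  assumes "\<xi> \<in> states G" "K \<subseteq> rates (fst \<xi>)"
  shows "continuous_on K (pre_hamiltonian G \<xi> p)"
  unfolding pre_hamiltonian_def[abs_def]
  by (intro continuous_intros continuous_on_subset[OF run_cost_cont assms(2)] assms(1))

definition radius where "radius M = 1 + 4 * (\<Lambda> + C * M) / \<gamma>"

lemma radius_pos: "0 \<le> M \<Longrightarrow> 0 < radius M"
  using gamma_pos Lambda_nonneg C_nonneg by (auto simp: radius_def intro!: add_pos_nonneg)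

text \<open>Strong convexity at the midpoint of \<open>a\<close> and \<open>0\<close> produces the
  gain \<open>\<gamma> / 4 * (norm a)\<^sup>2\<close>. Against it stand only
  \<open>\<Lambda>\<close>, from the running cost at 0, and the controlled jump term, at most
  \<open>C * norm a * M\<close>, because the running cost at the midpoint is nonnegative. For
  \<open>norm a > 1\<close> one factor \<open>norm a\<close> can be divided out, which is the origin
  of \<open>radius\<close>.\<close>

lemma coercive:
  assumes \<xi>: "\<xi> \<in> states G" and a: "a \<in> rates (fst \<xi>)" and p: "norm p \<le> M"
    and le: "pre_hamiltonian G \<xi> p a \<le> pre_hamiltonian G \<xi> p 0"
  shows "norm a \<le> radius M"
proof (cases "norm a \<le> 1")
  case True
  have "0 \<le> M" using p norm_ge_zero order_trans by blast
  then have "0 \<le> 4 * (\<Lambda> + C * M) / \<gamma>"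
    using gamma_pos Lambda_nonneg C_nonneg by auto
  with True show ?thesis by (simp add: radius_def)
next
  case False
  have "0 \<le> M" using p norm_ge_zero order_trans by blast
  have half: "(1/2) *\<^sub>R a \<in> rates (fst \<xi>)"
    using a by (simp add: rates_def)
  have "pre_hamiltonian G \<xi> p ((1/2) *\<^sub>R a) + \<gamma> / 4 * (norm a)\<^sup>2 \<le> pre_hamiltonian G \<xi> p 0"
    using strongly_convex_on_midpoint[OF pre_hamiltonian_convex[OF \<xi> order_refl, of p] a zero_in_rates] le by simp
  moreover have "- (\<Sum>y\<in>UNIV - {fst \<xi>}. rate1 G \<xi> $ y * ((1/2) *\<^sub>R a) $ y * p $ y) \<le> C * norm a * M"
  proof -
    have "- (\<Sum>y\<in>UNIV - {fst \<xi>}. rate1 G \<xi> $ y * ((1/2) *\<^sub>R a) $ y * p $ y) \<le> C * norm ((1/2) *\<^sub>R a) * norm p"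
      using rate1_sum_le[OF \<xi>, where A = "UNIV - {fst \<xi>}" and a = "(1/2) *\<^sub>R a" and p = p] by linarith
    also have "\<dots> \<le> C * norm a * M"
      using C_nonneg p by (intro mult_mono) auto
    finally show ?thesis .
  qed
  moreover have "run_cost G \<xi> 0 \<le> \<Lambda>" "0 \<le> run_cost G \<xi> ((1/2) *\<^sub>R a)"
    using run_cost_0[OF \<xi>] run_cost_nonneg[OF \<xi> half] .
  ultimately have "\<gamma> / 4 * (norm a)\<^sup>2 \<le> \<Lambda> + C * norm a * M"
    by (simp add: pre_hamiltonian_alt)
  also have "\<dots> \<le> \<Lambda> * norm a + C * norm a * M"
    using False Lambda_nonneg by (simp add: mult_le_cancel_left1)
  finally have "norm a * (\<gamma> / 4 * norm a) \<le> norm a * (\<Lambda> + C * M)"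
    by (simp add: algebra_simps power2_eq_square)
  then have "\<gamma> / 4 * norm a \<le> \<Lambda> + C * M"
    using False by (subst (asm) mult_le_cancel_left_pos) auto
  then have "norm a \<le> 4 * (\<Lambda> + C * M) / \<gamma>"
    using gamma_pos by (simp add: field_simps)
  then show ?thesis by (simp add: radius_def)
qed

lemma compact_arg_min_exists:
  assumes \<xi>: "\<xi> \<in> states G" and K: "K \<subseteq> rates (fst \<xi>)" "compact K" "K \<noteq> {}"
  shows "\<exists>a. is_arg_min (pre_hamiltonian G \<xi> p) (\<lambda>a. a \<in> K) a"
  using continuous_attains_inf[OF K(2,3) pre_hamiltonian_cont[OF \<xi> K(1), of p]]
  by (auto simp: is_arg_min_linorder Bex_def)

text \<open>A competitor outside the ball is, by coercivity, worse than the rate 0, which the ball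
  contains.\<close>

lemma truncated_arg_min:
  assumes \<xi>: "\<xi> \<in> states G" and p: "norm p \<le> M" and R: "radius M \<le> R"
    and a: "is_arg_min (pre_hamiltonian G \<xi> p) (\<lambda>a. a \<in> rates (fst \<xi>) \<inter> cball 0 R) a"
  shows "is_arg_min (pre_hamiltonian G \<xi> p) (\<lambda>a. a \<in> rates (fst \<xi>)) a"
  unfolding is_arg_min_linorder
proof (intro conjI allI impI)
  fix b assume b: "b \<in> rates (fst \<xi>)"
  have "0 \<le> M" using p norm_ge_zero order_trans by blast
  then have a0: "pre_hamiltonian G \<xi> p a \<le> pre_hamiltonian G \<xi> p 0"
    using a radius_pos[of M] R by (auto simp: is_arg_min_linorder)
  show "pre_hamiltonian G \<xi> p a \<le> pre_hamiltonian G \<xi> p b"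
  proof (cases "pre_hamiltonian G \<xi> p b \<le> pre_hamiltonian G \<xi> p 0")
    case True
    then have "norm b \<le> R"
      using coercive[OF \<xi> b p] R by linarith
    then show ?thesis using a b by (auto simp: is_arg_min_linorder)
  qed (use a0 in linarith)
qed (use a in \<open>auto simp: is_arg_min_linorder\<close>)

text \<open>Only these two kinds of constraint set occur. They are listed explicitly because
  existence of a minimiser is argued differently for each: by compactness on a ball, and by
  reduction to a ball otherwise.\<close>

definition admissible :: "'d \<Rightarrow> (real ^ 'd) set \<Rightarrow> bool" where
  "admissible x K \<longleftrightarrow> K = rates x \<or> (\<exists>R\<ge>0. K = rates x \<inter> cball 0 R)"

lemma admissible_rates [simp]: "admissible x (rates x)"
  by (simp add: admissible_def)

lemma admissible_truncated [simp]: "0 \<le> R \<Longrightarrow> admissible x (rates x \<inter> cball 0 R)"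
  by (auto simp: admissible_def)

lemma admissibleD:
  assumes "admissible x K"
  shows "K \<subseteq> rates x" "convex K" "0 \<in> K"
  using assms by (auto simp: admissible_def convex_rates intro: convex_Int)

lemma opt_in_arg_min:
  assumes \<xi>: "\<xi> \<in> states G" and K: "admissible (fst \<xi>) K"
  shows "is_arg_min (pre_hamiltonian G \<xi> p) (\<lambda>a. a \<in> K) (opt_in K G \<xi> p)"
proof -
  have trunc: "\<exists>a. is_arg_min (pre_hamiltonian G \<xi> p) (\<lambda>a. a \<in> rates (fst \<xi>) \<inter> cball 0 R) a" if "0 \<le> R" for R
  proof (intro compact_arg_min_exists \<xi> closed_Int_compact closed_rates compact_cball)
    have "0 \<in> rates (fst \<xi>) \<inter> cball 0 R" using that by simp
    then show "rates (fst \<xi>) \<inter> cball 0 R \<noteq> {}" by blast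
  qed simp
  have "\<exists>a. is_arg_min (pre_hamiltonian G \<xi> p) (\<lambda>a. a \<in> K) a"
    using K unfolding admissible_def
  proof (elim disjE exE conjE)
    \<comment> \<open>The set of all rates is not compact, but by \<open>truncated_arg_min\<close> a
      minimiser on the ball of radius \<open>radius (norm p)\<close> is a global one.\<close>
    assume "K = rates (fst \<xi>)"
    then show ?thesis
      using trunc[of "radius (norm p)"] radius_pos[of "norm p"] truncated_arg_min[OF \<xi> order_refl order_refl]
      by fastforce
  qed (use trunc in simp)
  then show ?thesis
    unfolding opt_in_def
    using strongly_convex_on_arg_min_unique[OF pre_hamiltonian_convex[OF \<xi>] gamma_pos] admissibleD[OF K]
    by (blast intro: theI2)
qed

lemma opt_in_mem: "\<xi> \<in> states G \<Longrightarrow> admissible (fst \<xi>) K \<Longrightarrow> opt_in K G \<xi> p \<in> K"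
  using opt_in_arg_min[of \<xi> K p] by (simp add: is_arg_min_def)

lemma opt_in_le:
  "\<xi> \<in> states G \<Longrightarrow> admissible (fst \<xi>) K \<Longrightarrow> a \<in> K \<Longrightarrow>
     pre_hamiltonian G \<xi> p (opt_in K G \<xi> p) \<le> pre_hamiltonian G \<xi> p a"
  using opt_in_arg_min[of \<xi> K p] by (auto simp: is_arg_min_linorder)

text \<open>The double difference bound is exactly what
  \<open>strongly_convex_on_arg_min_dist\<close> asks for. As it ignores the size of the rates, one
  constant serves every ball and the whole unbounded set of rates.\<close>

lemma opt_in_lipschitz:
  assumes \<xi>: "\<xi> \<in> states G" and K: "admissible (fst \<xi>) K"
  shows "norm (opt_in K G \<xi> p - opt_in K G \<xi> q) \<le> C / \<gamma> * norm (p - q)"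
proof -
  have "norm (opt_in K G \<xi> p - opt_in K G \<xi> q) \<le> C * norm (p - q) / \<gamma>"
    using pre_hamiltonian_diff_diff_le[OF \<xi>, of q "opt_in K G \<xi> p" p "opt_in K G \<xi> q"] C_nonneg
    by (intro strongly_convex_on_arg_min_dist[OF pre_hamiltonian_convex[OF \<xi>] pre_hamiltonian_convex[OF \<xi>]
          gamma_pos _ opt_in_arg_min[OF \<xi> K, of q] opt_in_arg_min[OF \<xi> K, of p]] admissibleD[OF K])
       (simp_all add: norm_minus_commute)
  then show ?thesis by simp
qed

lemma opt_in_truncated:
  assumes \<xi>: "\<xi> \<in> states G" and p: "norm p \<le> M" and "0 \<le> M" and R: "radius M \<le> R"
  shows "opt_in (rates (fst \<xi>) \<inter> cball 0 R) G \<xi> p = opt_rate G \<xi> p"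
proof -
  have "0 \<le> R" using radius_pos[OF \<open>0 \<le> M\<close>] R by linarith
  then show ?thesis
    unfolding opt_rate_eq_opt_in
    by (intro strongly_convex_on_arg_min_unique[OF pre_hamiltonian_convex[OF \<xi> order_refl, of p] gamma_pos convex_rates]
        truncated_arg_min[OF \<xi> p R] opt_in_arg_min \<xi>) auto
qed

lemma hamiltonian_eq:
  assumes "\<xi> \<in> states G"
  shows "hamiltonian G \<xi> p = pre_hamiltonian G \<xi> p (opt_rate G \<xi> p)"
  unfolding hamiltonian_def
proof (rule cInf_eq_minimum)
  show "pre_hamiltonian G \<xi> p (opt_rate G \<xi> p) \<in> pre_hamiltonian G \<xi> p ` rates (fst \<xi>)"
    using opt_in_mem[OF assms admissible_rates] by (simp add: opt_rate_eq_opt_in)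
qed (use opt_in_le[OF assms admissible_rates] in \<open>auto simp: opt_rate_eq_opt_in\<close>)

text \<open>The minimiser for \<open>q\<close> is used as a competitor for \<open>p\<close>, and
  conversely. Its size enters the constant, and this is the reason for truncating the rates before
  solving the equation.\<close>

lemma truncated_hamiltonian_lipschitz:
  assumes \<xi>: "\<xi> \<in> states G" and "0 \<le> R"
  defines "K \<equiv> rates (fst \<xi>) \<inter> cball 0 R"
  shows "\<bar>pre_hamiltonian G \<xi> p (opt_in K G \<xi> p) - pre_hamiltonian G \<xi> q (opt_in K G \<xi> q)\<bar>
      \<le> C * (1 + R) * norm (p - q)"
proof -
  have K: "admissible (fst \<xi>) K" using \<open>0 \<le> R\<close> by (simp add: K_def)
  have le: "pre_hamiltonian G \<xi> p (opt_in K G \<xi> p) - pre_hamiltonian G \<xi> q (opt_in K G \<xi> q)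
      \<le> C * (1 + R) * norm (p - q)" for p q
  proof -
    have "opt_in K G \<xi> q \<in> K" using opt_in_mem[OF \<xi> K] .
    then have R: "norm (opt_in K G \<xi> q) \<le> R" by (simp add: K_def)
    have "pre_hamiltonian G \<xi> p (opt_in K G \<xi> p) \<le> pre_hamiltonian G \<xi> p (opt_in K G \<xi> q)"
      using opt_in_le[OF \<xi> K \<open>opt_in K G \<xi> q \<in> K\<close>] .
    moreover have "C * (1 + norm (opt_in K G \<xi> q)) * norm (p - q) \<le> C * (1 + R) * norm (p - q)"
      using R C_nonneg by (intro mult_right_mono mult_left_mono) auto
    ultimately show ?thesis
      using pre_hamiltonian_diff_le[OF \<xi>, of p "opt_in K G \<xi> q" q] by linarith
  qed
  show ?thesis using le[of p q] le[of q p] by (simp add: abs_le_iff norm_minus_commute)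
qed

end

section \<open>Backward differential equations\<close>

lemma integral_lower_limit_has_derivative:
  fixes f :: "real \<Rightarrow> real"
  assumes f: "continuous_on {a..b} f" and t: "t \<in> {a..b}"
  shows "((\<lambda>t. integral {t..b} f) has_real_derivative - f t) (at t within {a..b})"
proof (rule has_field_derivative_transform_within[where d = 1])
  show "((\<lambda>t. integral {a..b} f - integral {a..t} f) has_real_derivative - f t) (at t within {a..b})"
    using integral_has_real_derivative[OF f t] by (auto intro!: derivative_eq_intros)
  fix s assume "s \<in> {a..b}"
  then show "integral {a..b} f - integral {a..s} f = integral {s..b} f"
    using Henstock_Kurzweil_Integration.integral_combine[of a s b f] integrable_continuous_interval[OF f] by simp
qed (use t in auto)

lemma integral_exp_weight_le:
  fixes t T \<theta> :: real
  assumes "0 < \<theta>" "t \<le> T"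
  shows "integral {t..T} (\<lambda>s. exp (\<theta> * (T - s))) \<le> exp (\<theta> * (T - t)) / \<theta>"
proof -
  have "((\<lambda>s. exp (\<theta> * (T - s))) has_integral (- exp (\<theta> * (T - T)) / \<theta>) - (- exp (\<theta> * (T - t)) / \<theta>)) {t..T}"
    using assms
    by (intro fundamental_theorem_of_calculus)
       (auto intro!: derivative_eq_intros simp flip: has_real_derivative_iff_has_vector_derivative)
  then show ?thesis
    using assms by (auto dest: integral_unique)
qed

text \<open>
  Picard iteration. In the norm weighted by \<open>exp (\<theta> (T - t))\<close>, with \<open>\<theta> > 2 L |S|\<close>,
  each step at least halves the distance of successive iterates.
\<close>

lemma backward_ode_exists:
  fixes F :: "real \<Rightarrow> ('a \<Rightarrow> real) \<Rightarrow> 'a \<Rightarrow> real" and g :: "'a \<Rightarrow> real"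
  assumes S: "finite S" and "0 \<le> T" and "0 \<le> L"
    and cont: "\<And>u \<xi>. \<xi> \<in> S \<Longrightarrow> (\<And>\<eta>. \<eta> \<in> S \<Longrightarrow> continuous_on {0..T} (\<lambda>t. u t \<eta>)) \<Longrightarrow>
                 continuous_on {0..T} (\<lambda>t. F t (u t) \<xi>)"
    and lip: "\<And>t u w \<xi>. t \<in> {0..T} \<Longrightarrow> \<xi> \<in> S \<Longrightarrow>
                 \<bar>F t u \<xi> - F t w \<xi>\<bar> \<le> L * (\<Sum>\<eta>\<in>S. \<bar>u \<eta> - w \<eta>\<bar>)"
  obtains w where "\<And>\<xi>. \<xi> \<in> S \<Longrightarrow> w T \<xi> = g \<xi>"
    "\<And>t \<xi>. t \<in> {0..T} \<Longrightarrow> \<xi> \<in> S \<Longrightarrow>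
       ((\<lambda>t. w t \<xi>) has_real_derivative - F t (w t) \<xi>) (at t within {0..T})"
proof -
  define P where "P u t \<xi> = g \<xi> + integral {t..T} (\<lambda>s. F s (u s) \<xi>)" for u t \<xi>
  define W where "W k = (P ^^ k) (\<lambda>t. g)" for k
  have W0: "W 0 t \<xi> = g \<xi>" and WSuc: "W (Suc k) = P (W k)" for k t \<xi>
    by (simp_all add: W_def)
  have derivP: "((\<lambda>t. P u t \<xi>) has_real_derivative - F t (u t) \<xi>) (at t within {0..T})"
    if "\<And>\<eta>. \<eta> \<in> S \<Longrightarrow> continuous_on {0..T} (\<lambda>t. u t \<eta>)" "\<xi> \<in> S" "t \<in> {0..T}" for u t \<xi>
    unfolding P_def using integral_lower_limit_has_derivative[OF cont[OF that(2,1)] that(3)]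
    by (auto intro!: derivative_eq_intros)
  have contW: "continuous_on {0..T} (\<lambda>t. W k t \<xi>)" if "\<xi> \<in> S" for k \<xi>
    using that
  proof (induction k arbitrary: \<xi>)
    case (Suc k)
    then show ?case unfolding WSuc by (intro DERIV_continuous_on[OF derivP]) auto
  qed (simp add: W0)
  have contFW: "continuous_on {t..T} (\<lambda>s. F s (W k s) \<xi>)" if "\<xi> \<in> S" "t \<in> {0..T}" for k \<xi> t
    using cont[OF that(1) contW] by (rule continuous_on_subset) (use that in auto)
  \<comment> \<open>The summand 1 keeps \<open>\<theta>\<close> positive when
    \<open>L * card S\<close> vanishes.\<close>
  define \<theta> where "\<theta> = 2 * L * real (card S) + 1"
  have \<theta>: "0 < \<theta>" using \<open>0 \<le> L\<close> by (simp add: \<theta>_def add_nonneg_pos)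
  have "continuous_on {0..T} (\<lambda>t. \<Sum>\<xi>\<in>S. \<bar>W 1 t \<xi> - W 0 t \<xi>\<bar>)"
    by (intro continuous_intros contW)
  from compact_imp_bounded[OF compact_continuous_image[OF this compact_Icc]]
  obtain A where A: "\<And>t. t \<in> {0..T} \<Longrightarrow> norm (\<Sum>\<xi>\<in>S. \<bar>W 1 t \<xi> - W 0 t \<xi>\<bar>) \<le> A"
    unfolding bounded_iff by (meson imageI)
  have "0 \<le> A" using order_trans[OF norm_ge_zero A[of 0]] \<open>0 \<le> T\<close> by simp
  have diff: "\<bar>W (Suc k) t \<xi> - W k t \<xi>\<bar> \<le> A * (1/2) ^ k * exp (\<theta> * (T - t))"
    if "t \<in> {0..T}" "\<xi> \<in> S" for k t \<xi>
    using that
  proof (induction k arbitrary: t \<xi>)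
    case 0
    have "\<bar>W 1 t \<xi> - W 0 t \<xi>\<bar> \<le> (\<Sum>\<xi>\<in>S. \<bar>W 1 t \<xi> - W 0 t \<xi>\<bar>)"
      using 0 S by (intro member_le_sum) auto
    also have "\<dots> \<le> A" using A[OF 0(1)] by simp
    also have "\<dots> \<le> A * exp (\<theta> * (T - t))"
      using \<open>0 \<le> A\<close> \<theta> 0 by (simp add: mult_le_cancel_left1)
    finally show ?case by simp
  next
    case (Suc k)
    let ?B = "L * (real (card S) * (A * (1/2) ^ k))"
    have B: "0 \<le> ?B" using \<open>0 \<le> A\<close> \<open>0 \<le> L\<close> by simp
    have int: "(\<lambda>s. F s (W j s) \<xi>) integrable_on {t..T}" for j
      by (rule integrable_continuous_interval[OF contFW[OF Suc.prems(2,1)]])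
    have "W (Suc (Suc k)) t \<xi> - W (Suc k) t \<xi>
        = integral {t..T} (\<lambda>s. F s (W (Suc k) s) \<xi> - F s (W k s) \<xi>)"
      unfolding integral_diff[OF int int] by (simp add: WSuc[of "Suc k"] WSuc[of k] P_def[abs_def])
    also have "\<bar>\<dots>\<bar> \<le> integral {t..T} (\<lambda>s. ?B * exp (\<theta> * (T - s)))"
      unfolding real_norm_def[symmetric]
    proof (rule integral_norm_bound_integral)
      show "(\<lambda>s. F s (W (Suc k) s) \<xi> - F s (W k s) \<xi>) integrable_on {t..T}"
        by (intro integrable_diff int)
      show "(\<lambda>s. ?B * exp (\<theta> * (T - s))) integrable_on {t..T}"
        by (intro integrable_continuous_interval continuous_intros)
      fix s assume s: "s \<in> {t..T}"
      then have s0: "s \<in> {0..T}" using Suc.prems by auto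
      have "\<bar>F s (W (Suc k) s) \<xi> - F s (W k s) \<xi>\<bar> \<le> L * (\<Sum>\<eta>\<in>S. \<bar>W (Suc k) s \<eta> - W k s \<eta>\<bar>)"
        by (rule lip[OF s0 Suc.prems(2)])
      also have "\<dots> \<le> L * (\<Sum>\<eta>\<in>S. A * (1/2) ^ k * exp (\<theta> * (T - s)))"
        using \<open>0 \<le> L\<close> s0 by (intro mult_left_mono sum_mono Suc.IH) auto
      finally show "norm (F s (W (Suc k) s) \<xi> - F s (W k s) \<xi>) \<le> ?B * exp (\<theta> * (T - s))"
        by (simp add: mult_ac)
    qed
    also have "\<dots> \<le> ?B * (exp (\<theta> * (T - t)) / \<theta>)"
      using mult_left_mono[OF integral_exp_weight_le[OF \<theta>, of t T] B] Suc.prems by simp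
    also have "\<dots> = (L * real (card S) / \<theta>) * (A * (1/2) ^ k * exp (\<theta> * (T - t)))"
      by simp
    also have "\<dots> \<le> (1/2) * (A * (1/2) ^ k * exp (\<theta> * (T - t)))"
      using \<theta> \<open>0 \<le> A\<close> \<open>0 \<le> L\<close>
      by (intro mult_right_mono) (auto simp: \<theta>_def field_simps)
    finally show ?case by simp
  qed
  \<comment> \<open>The limit is written as a telescoping series so that the geometric bound on
    successive differences yields uniform convergence by the Weierstrass test.\<close>
  define w where "w t \<xi> = g \<xi> + (\<Sum>i. W (Suc i) t \<xi> - W i t \<xi>)" for t \<xi>
  have unif: "uniform_limit {0..T} (\<lambda>n t. W n t \<xi>) (\<lambda>t. w t \<xi>) sequentially" if "\<xi> \<in> S" for \<xi>
  proof -
    have "uniform_limit {0..T} (\<lambda>n t. \<Sum>i<n. W (Suc i) t \<xi> - W i t \<xi>)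
        (\<lambda>t. \<Sum>i. W (Suc i) t \<xi> - W i t \<xi>) sequentially"
    proof (rule Weierstrass_m_test)
      show "summable (\<lambda>n. A * exp (\<theta> * T) * (1/2) ^ n)"
        by (intro summable_mult summable_geometric) simp
      fix n t assume t: "t \<in> {0..T}"
      have "\<bar>W (Suc n) t \<xi> - W n t \<xi>\<bar> \<le> A * (1/2) ^ n * exp (\<theta> * (T - t))"
        by (rule diff[OF t that])
      also have "\<dots> \<le> A * (1/2) ^ n * exp (\<theta> * T)"
        using \<open>0 \<le> A\<close> \<theta> t by (intro mult_left_mono) auto
      finally show "norm (W (Suc n) t \<xi> - W n t \<xi>) \<le> A * exp (\<theta> * T) * (1/2) ^ n"
        by (simp add: mult_ac)
    qed
    moreover have "(\<Sum>i<n. W (Suc i) t \<xi> - W i t \<xi>) = W n t \<xi> - g \<xi>" for n t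
      using sum_lessThan_telescope[of "\<lambda>i. W i t \<xi>" n] by (simp add: W0)
    ultimately have "uniform_limit {0..T} (\<lambda>n t. W n t \<xi> - g \<xi>)
        (\<lambda>t. \<Sum>i. W (Suc i) t \<xi> - W i t \<xi>) sequentially"
      by simp
    from uniform_limit_add[OF uniform_limit_const[of "\<lambda>_. g \<xi>"] this]
    show ?thesis
      by (simp add: w_def)
  qed
  have contw: "continuous_on {0..T} (\<lambda>t. w t \<xi>)" if "\<xi> \<in> S" for \<xi>
    by (rule uniform_limit_theorem[OF _ unif[OF that]]) (auto intro!: always_eventually contW that)
  have fixpoint: "w t \<xi> = P w t \<xi>" if t: "t \<in> {0..T}" and \<xi>: "\<xi> \<in> S" for t \<xi>
  proof -
    \<comment> \<open>The Lipschitz bound on \<open>F\<close> carries uniform convergence from the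
      iterates to the integrands, which allows the limit to pass under the integral.\<close>
    have "uniform_limit {t..T} (\<lambda>n s. F s (W n s) \<xi>) (\<lambda>s. F s (w s) \<xi>) sequentially"
      unfolding uniform_limit_iff
    proof (intro allI impI)
      fix e :: real assume "0 < e"
      define d where "d = e / (L * real (card S) + 1)"
      have pos: "0 < L * real (card S) + 1" using \<open>0 \<le> L\<close> by (simp add: add_nonneg_pos)
      then have "0 < d" using \<open>0 < e\<close> by (simp add: d_def)
      have "\<forall>\<^sub>F n in sequentially. \<forall>\<eta>\<in>S. \<forall>s\<in>{0..T}. dist (W n s \<eta>) (w s \<eta>) < d"
        using S uniform_limitD[OF unif \<open>0 < d\<close>] by (simp add: eventually_ball_finite)
      then show "\<forall>\<^sub>F n in sequentially. \<forall>s\<in>{t..T}. dist (F s (W n s) \<xi>) (F s (w s) \<xi>) < e"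
      proof eventually_elim
        case (elim n)
        show ?case
        proof
          fix s assume "s \<in> {t..T}"
          with t have s: "s \<in> {0..T}" by auto
          have "\<bar>F s (W n s) \<xi> - F s (w s) \<xi>\<bar> \<le> L * (\<Sum>\<eta>\<in>S. \<bar>W n s \<eta> - w s \<eta>\<bar>)"
            by (rule lip[OF s \<xi>])
          also have "\<dots> \<le> L * (\<Sum>\<eta>\<in>S. d)"
            using elim s \<open>0 \<le> L\<close> by (intro mult_left_mono sum_mono) (auto simp: dist_real_def less_imp_le)
          also have "\<dots> < (L * real (card S) + 1) * d"
            using \<open>0 < d\<close> by (simp add: algebra_simps)
          also have "\<dots> = e" using pos by (simp add: d_def)
          finally show "dist (F s (W n s) \<xi>) (F s (w s) \<xi>) < e"
            by (simp add: dist_real_def)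
        qed
      qed
    qed
    then obtain I J where IJ: "\<And>n. ((\<lambda>s. F s (W n s) \<xi>) has_integral I n) {t..T}"
      "((\<lambda>s. F s (w s) \<xi>) has_integral J) {t..T}" "I \<longlonglongrightarrow> J"
      by (rule uniform_limit_integral[OF _ contFW[OF \<xi> t] sequentially_bot]) (rule that)
    have "(\<lambda>n. W (Suc n) t \<xi>) \<longlonglongrightarrow> P w t \<xi>"
      using tendsto_add[OF tendsto_const IJ(3), of "g \<xi>"] integral_unique[OF IJ(1)] integral_unique[OF IJ(2)]
      by (simp add: WSuc P_def)
    moreover have "(\<lambda>n. W (Suc n) t \<xi>) \<longlonglongrightarrow> w t \<xi>"
      using tendsto_uniform_limitI[OF unif[OF \<xi>] t] by (rule LIMSEQ_Suc)
    ultimately show ?thesis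
      using LIMSEQ_unique by blast
  qed
  show thesis
  proof (rule that)
    fix \<xi> assume \<xi>: "\<xi> \<in> S"
    show "w T \<xi> = g \<xi>"
      using fixpoint[of T \<xi>] \<xi> \<open>0 \<le> T\<close> by (simp add: P_def)
    fix t assume t: "t \<in> {0..T}"
    show "((\<lambda>t. w t \<xi>) has_real_derivative - F t (w t) \<xi>) (at t within {0..T})"
      by (rule has_field_derivative_transform_within[OF derivP[OF contw \<xi> t] zero_less_one t])
         (simp_all add: fixpoint \<xi>)
  qed
qed

section \<open>Value functions and the learning iteration\<close>

lemma shifted_states:
  assumes "(x, \<mu>) \<in> states G" "0 < pop G" "\<mu> $ z \<noteq> 0"
  shows "(x', \<mu> + shift G y z) \<in> states G"
  using shift_in_grid[of \<mu> G z y] assms by (simp add: states_def)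

lemma states_change_fst: "(x, \<mu>) \<in> states G \<Longrightarrow> (y, \<mu>) \<in> states G"
  by (simp add: states_def)

lemma states_component_bounds:
  assumes "(x, \<mu>) \<in> states G"
  shows "0 \<le> \<mu> $ z" "\<mu> $ z \<le> 1"
proof -
  obtain k where "k \<le> pop G" "\<mu> $ z = real k / real (pop G)"
    using assms by (auto simp: states_def grid_def)
  then show "0 \<le> \<mu> $ z" "\<mu> $ z \<le> 1" by (auto simp: divide_le_eq_1)
qed

lemma norm_diff_x_diff_le:
  fixes \<phi> \<psi> :: "'d::finite state \<Rightarrow> real"
  assumes "\<xi> \<in> states G" and le: "\<And>\<eta>. \<eta> \<in> states G \<Longrightarrow> \<bar>\<phi> \<eta> - \<psi> \<eta>\<bar> \<le> c"
  shows "norm (diff_x \<phi> \<xi> - diff_x \<psi> \<xi>) \<le> 2 * real CARD('d) * c"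
proof -
  obtain x \<mu> where \<xi>: "\<xi> = (x, \<mu>)" by (cases \<xi>)
  have "norm (diff_x \<phi> \<xi> - diff_x \<psi> \<xi>) \<le> (\<Sum>y\<in>UNIV. \<bar>(diff_x \<phi> \<xi> - diff_x \<psi> \<xi>) $ y\<bar>)"
    by (rule norm_le_l1_cart)
  also have "\<dots> \<le> (\<Sum>y\<in>(UNIV::'d set). 2 * c)"
  proof (rule sum_mono)
    fix y
    have "(y, \<mu>) \<in> states G" using assms(1) \<xi> states_change_fst by blast
    then show "\<bar>(diff_x \<phi> \<xi> - diff_x \<psi> \<xi>) $ y\<bar> \<le> 2 * c"
      using le[of "(y, \<mu>)"] le[of "(x, \<mu>)"] assms(1) \<xi> by simp
  qed
  finally show ?thesis by simp
qed

lemma diff_x_cong: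
  assumes "\<xi> \<in> states G" "\<And>\<eta>. \<eta> \<in> states G \<Longrightarrow> \<phi> \<eta> = \<psi> \<eta>"
  shows "diff_x \<phi> \<xi> = diff_x \<psi> \<xi>"
  using norm_diff_x_diff_le[of \<xi> G \<phi> \<psi> 0] assms by simp

lemma diff_x_add_const [simp]: "diff_x (\<lambda>\<eta>. \<phi> \<eta> + c) \<xi> = diff_x \<phi> \<xi>"
  by (cases \<xi>) simp

lemma gen_mu_add_const [simp]: "gen_mu G \<beta> (\<lambda>\<eta>. \<phi> \<eta> + c) t \<xi> = gen_mu G \<beta> \<phi> t \<xi>"
  by (cases \<xi>) simp

lemma gen_x_const [simp]: "gen_x G \<alpha> (\<lambda>\<eta>. c) t \<xi> = 0"
  by (cases \<xi>) simp

lemma gen_mu_const [simp]: "gen_mu G \<beta> (\<lambda>\<eta>. c) t \<xi> = 0"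
  by (cases \<xi>) simp

text \<open>This turns the integrand of Dynkin's formula into the pre-Hamiltonian, so controls can
  be compared pointwise through its minimiser.\<close>

lemma run_cost_plus_gen_x:
  "run_cost G \<xi> (\<alpha> t \<xi>) + gen_x G \<alpha> \<phi> t \<xi> = pre_hamiltonian G \<xi> (diff_x \<phi> \<xi>) (\<alpha> t \<xi>)"
  by (cases \<xi>) (simp add: pre_hamiltonian_def)

lemma continuous_on_diff_x:
  assumes "\<xi> \<in> states G" "\<And>\<eta>. \<eta> \<in> states G \<Longrightarrow> continuous_on A (\<lambda>t. u t \<eta>)"
  shows "continuous_on A (\<lambda>t. diff_x (u t) \<xi>)"
proof -
  obtain x \<mu> where \<xi>: "\<xi> = (x, \<mu>)" by (cases \<xi>)
  show ?thesis
    unfolding \<xi> diff_x.simps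
    using assms \<xi> states_change_fst by (intro continuous_intros) blast+
qed

lemma controls_rates: "\<alpha> \<in> controls G \<Longrightarrow> t \<in> {0..horizon G} \<Longrightarrow> \<xi> \<in> states G \<Longrightarrow> \<alpha> t \<xi> \<in> rates (fst \<xi>)"
  by (auto simp: controls_def)

lemma controls_continuous: "\<alpha> \<in> controls G \<Longrightarrow> \<xi> \<in> states G \<Longrightarrow> continuous_on {0..horizon G} (\<lambda>t. \<alpha> t \<xi>)"
  by (auto simp: controls_def intro: lipschitz_on_continuous_on)

text \<open>Needed because the best response is identified with a feedback control only on the time
  interval and the actual states.\<close>

lemma controls_cong:
  assumes "\<alpha> \<in> controls G" "\<And>t \<xi>. t \<in> {0..horizon G} \<Longrightarrow> \<xi> \<in> states G \<Longrightarrow> \<beta> t \<xi> = \<alpha> t \<xi>"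
  shows "\<beta> \<in> controls G"
proof -
  obtain L where L: "\<forall>\<xi>\<in>states G. L-lipschitz_on {0..horizon G} (\<lambda>t. \<alpha> t \<xi>)"
    using assms(1) by (auto simp: controls_def)
  have "L-lipschitz_on {0..horizon G} (\<lambda>t. \<beta> t \<xi>)" if "\<xi> \<in> states G" for \<xi>
    using L that assms(2)[OF _ that] by (simp add: lipschitz_on_def)
  then have "\<exists>L. \<forall>\<xi>\<in>states G. L-lipschitz_on {0..horizon G} (\<lambda>t. \<beta> t \<xi>)"
    by blast
  with assms show ?thesis by (auto simp: controls_def)
qed

lemma zero_control: "(\<lambda>t \<xi>. 0) \<in> controls G"
proof -
  have "\<forall>\<xi>\<in>states G. 0-lipschitz_on {0..horizon G} (\<lambda>t. 0 :: real ^ 'a)"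
    by (auto intro: lipschitz_intros)
  then show ?thesis unfolding controls_def by auto
qed

lemma controls_convex_combination:
  assumes \<alpha>: "\<alpha> \<in> controls G" and \<beta>: "\<beta> \<in> controls G" and \<rho>: "0 \<le> \<rho>" "\<rho> \<le> 1"
  shows "(\<lambda>t \<xi>. \<rho> *\<^sub>R \<alpha> t \<xi> + (1 - \<rho>) *\<^sub>R \<beta> t \<xi>) \<in> controls G"
proof -
  obtain L L' where "\<forall>\<xi>\<in>states G. L-lipschitz_on {0..horizon G} (\<lambda>t. \<alpha> t \<xi>)"
    "\<forall>\<xi>\<in>states G. L'-lipschitz_on {0..horizon G} (\<lambda>t. \<beta> t \<xi>)"
    using \<alpha> \<beta> by (auto simp: controls_def)
  then have "\<forall>\<xi>\<in>states G. (\<bar>\<rho>\<bar> * L + \<bar>1 - \<rho>\<bar> * L')-lipschitz_on {0..horizon G}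
      (\<lambda>t. \<rho> *\<^sub>R \<alpha> t \<xi> + (1 - \<rho>) *\<^sub>R \<beta> t \<xi>)"
    by (auto intro!: lipschitz_on_add lipschitz_on_cmult)
  moreover have "\<rho> *\<^sub>R \<alpha> t \<xi> + (1 - \<rho>) *\<^sub>R \<beta> t \<xi> \<in> rates (fst \<xi>)"
    if "t \<in> {0..horizon G}" "\<xi> \<in> states G" for t \<xi>
    using controls_rates[OF \<alpha> that] controls_rates[OF \<beta> that] \<rho> by (auto simp: rates_def)
  ultimately show ?thesis unfolding controls_def by blast
qed

lemma continuous_family_bounded:
  fixes f :: "real \<Rightarrow> 'a \<Rightarrow> 'b::real_normed_vector"
  assumes "finite S" "\<And>\<xi>. \<xi> \<in> S \<Longrightarrow> continuous_on {a..b} (\<lambda>t. f t \<xi>)"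
  obtains B where "0 \<le> B" "\<And>t \<xi>. t \<in> {a..b} \<Longrightarrow> \<xi> \<in> S \<Longrightarrow> norm (f t \<xi>) \<le> B"
proof -
  have "continuous_on {a..b} (\<lambda>t. \<Sum>\<xi>\<in>S. norm (f t \<xi>))"
    by (intro continuous_intros assms(2))
  from compact_imp_bounded[OF compact_continuous_image[OF this compact_Icc]]
  obtain B where B: "\<And>t. t \<in> {a..b} \<Longrightarrow> norm (\<Sum>\<xi>\<in>S. norm (f t \<xi>)) \<le> B"
    unfolding bounded_iff by (meson imageI)
  show thesis
  proof (rule that[of "\<bar>B\<bar>"])
    fix t \<xi> assume t: "t \<in> {a..b}" and \<xi>: "\<xi> \<in> S"
    have "norm (f t \<xi>) \<le> (\<Sum>\<xi>\<in>S. norm (f t \<xi>))"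
      using \<xi> assms(1) by (intro member_le_sum) auto
    with B[OF t] show "norm (f t \<xi>) \<le> \<bar>B\<bar>" by simp
  qed simp
qed

section \<open>Estimates for the population generator and regularity of feedback\<close>

context strongly_convex_game
begin

text \<open>One summand per ordered pair, each with jump weight at most \<open>pop G\<close>, since
  grid entries are at most 1, rate bound \<open>\<Lambda>\<close>, and a factor 2 for the two values
  in an increment.\<close>

definition D where "D = 2 * real (card {(y, z). y \<noteq> (z :: 'd)}) * real (pop G) * \<Lambda>"

lemma D_nonneg: "0 \<le> D"
  using Lambda_nonneg by (simp add: D_def)

text \<open>The bounds on \<open>a\<close> and \<open>b\<close> are conditional because for
  \<open>\<mu> $ z = 0\<close> the shifted states may leave the grid, where the data are
  uncontrolled; the vanishing weight then settles the claim.\<close>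

lemma gen_mu_term_le:
  assumes \<xi>: "(x, \<mu>) \<in> states G"
    and ab: "\<mu> $ z \<noteq> 0 \<Longrightarrow> \<bar>a\<bar> \<le> \<Lambda> * A" "\<mu> $ z \<noteq> 0 \<Longrightarrow> \<bar>b\<bar> \<le> 2 * B" and "0 \<le> A" "0 \<le> B"
  shows "\<bar>real (pop G) * \<mu> $ z * a * b\<bar> \<le> 2 * real (pop G) * \<Lambda> * (A * B)"
proof (cases "\<mu> $ z = 0")
  case True
  then show ?thesis using assms(4,5) Lambda_nonneg by simp
next
  case False
  have "\<bar>real (pop G) * \<mu> $ z * a * b\<bar> = real (pop G) * \<mu> $ z * \<bar>a\<bar> * \<bar>b\<bar>"
    using states_component_bounds[OF \<xi>] by (simp add: abs_mult)
  also have "\<dots> \<le> real (pop G) * 1 * (\<Lambda> * A) * (2 * B)"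
    using ab[OF False] states_component_bounds[OF \<xi>, of z] assms(4,5) Lambda_nonneg
    by (intro mult_mono) auto
  finally show ?thesis by (simp add: mult_ac)
qed

lemma sum_pairs_le:
  assumes "\<And>y z. y \<noteq> z \<Longrightarrow> \<bar>f (y, z)\<bar> \<le> 2 * real (pop G) * \<Lambda> * e"
  shows "\<bar>\<Sum>yz\<in>{(y, z). y \<noteq> (z :: 'd)}. f yz\<bar> \<le> D * e"
proof -
  have "\<bar>\<Sum>yz\<in>{(y, z). y \<noteq> (z :: 'd)}. f yz\<bar> \<le> (\<Sum>yz\<in>{(y, z). y \<noteq> (z :: 'd)}. 2 * real (pop G) * \<Lambda> * e)"
    by (rule order_trans[OF sum_abs sum_mono]) (use assms in auto)
  then show ?thesis by (simp add: D_def mult_ac)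
qed

lemma gen_mu_diff_phi_le:
  assumes \<xi>: "\<xi> \<in> states G" and \<beta>: "\<And>\<zeta>. \<zeta> \<in> states G \<Longrightarrow> norm (\<beta> t \<zeta>) \<le> B" and "0 \<le> B"
    and e: "\<And>\<zeta>. \<zeta> \<in> states G \<Longrightarrow> \<bar>\<phi> \<zeta> - \<psi> \<zeta>\<bar> \<le> e"
  shows "\<bar>gen_mu G \<beta> \<phi> t \<xi> - gen_mu G \<beta> \<psi> t \<xi>\<bar> \<le> D * ((1 + B) * e)"
proof -
  obtain x \<mu> where [simp]: "\<xi> = (x, \<mu>)" by (cases \<xi>)
  have "0 \<le> e" using e[OF \<xi>] by linarith
  have "gen_mu G \<beta> \<phi> t \<xi> - gen_mu G \<beta> \<psi> t \<xi> =
     (\<Sum>yz\<in>{(y, z). y \<noteq> z}. (\<lambda>(y, z). real (pop G) * \<mu> $ z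
        * (rate0 G (z, \<mu> + shift G x z) $ y
           + rate1 G (z, \<mu> + shift G x z) $ y * \<beta> t (z, \<mu> + shift G x z) $ y)
        * ((\<phi> (x, \<mu> + shift G y z) - \<psi> (x, \<mu> + shift G y z)) - (\<phi> (x, \<mu>) - \<psi> (x, \<mu>)))) yz)"
    by (simp add: sum_subtractf[symmetric] case_prod_unfold right_diff_distrib algebra_simps)
  also have "\<bar>\<dots>\<bar> \<le> D * ((1 + B) * e)"
  proof (intro sum_pairs_le, unfold prod.case, intro gen_mu_term_le)
    fix y z assume z: "\<mu> $ z \<noteq> 0"
    let ?\<zeta> = "(z, \<mu> + shift G x z)"
    have \<zeta>: "?\<zeta> \<in> states G" "(x, \<mu> + shift G y z) \<in> states G"
      using shifted_states \<xi> pop_pos z by auto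
    have "\<bar>rate1 G ?\<zeta> $ y * \<beta> t ?\<zeta> $ y\<bar> \<le> \<Lambda> * B"
      unfolding abs_mult
      by (intro mult_mono order_trans[OF component_le_norm_cart] rate1_bound \<beta> \<zeta> Lambda_nonneg) auto
    moreover have "\<bar>rate0 G ?\<zeta> $ y\<bar> \<le> \<Lambda>"
      by (intro order_trans[OF component_le_norm_cart] rate0_bound \<zeta>)
    ultimately show "\<bar>rate0 G ?\<zeta> $ y + rate1 G ?\<zeta> $ y * \<beta> t ?\<zeta> $ y\<bar> \<le> \<Lambda> * (1 + B)"
      by (simp add: algebra_simps)
    show "\<bar>(\<phi> (x, \<mu> + shift G y z) - \<psi> (x, \<mu> + shift G y z)) - (\<phi> (x, \<mu>) - \<psi> (x, \<mu>))\<bar> \<le> 2 * e"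
      using e[OF \<zeta>(2)] e[OF \<xi>] by simp
  qed (use \<xi> \<open>0 \<le> B\<close> \<open>0 \<le> e\<close> in auto)
  finally show ?thesis .
qed

text \<open>The generator is affine in the control, so the uncontrolled rates cancel and neither
  control's size enters. Applied to \<open>v\<close>, this makes the stability constant the same for
  all iterates.\<close>

lemma gen_mu_diff_beta_le:
  assumes \<xi>: "\<xi> \<in> states G" and b: "\<And>\<zeta>. \<zeta> \<in> states G \<Longrightarrow> norm (\<beta> t \<zeta> - \<beta>' t \<zeta>) \<le> b"
    and M: "\<And>\<zeta>. \<zeta> \<in> states G \<Longrightarrow> \<bar>\<phi> \<zeta>\<bar> \<le> M"
  shows "\<bar>gen_mu G \<beta> \<phi> t \<xi> - gen_mu G \<beta>' \<phi> t \<xi>\<bar> \<le> D * (b * M)"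
proof -
  obtain x \<mu> where [simp]: "\<xi> = (x, \<mu>)" by (cases \<xi>)
  have "0 \<le> b" using order_trans[OF norm_ge_zero b[OF \<xi>]] .
  have "0 \<le> M" using M[OF \<xi>] by linarith
  have "gen_mu G \<beta> \<phi> t \<xi> - gen_mu G \<beta>' \<phi> t \<xi> =
     (\<Sum>yz\<in>{(y, z). y \<noteq> z}. (\<lambda>(y, z). real (pop G) * \<mu> $ z
        * (rate1 G (z, \<mu> + shift G x z) $ y * (\<beta> t (z, \<mu> + shift G x z) - \<beta>' t (z, \<mu> + shift G x z)) $ y)
        * (\<phi> (x, \<mu> + shift G y z) - \<phi> (x, \<mu>))) yz)"
    by (simp add: sum_subtractf[symmetric] case_prod_unfold algebra_simps)
  also have "\<bar>\<dots>\<bar> \<le> D * (b * M)"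
  proof (intro sum_pairs_le, unfold prod.case, intro gen_mu_term_le)
    fix y z assume z: "\<mu> $ z \<noteq> 0"
    let ?\<zeta> = "(z, \<mu> + shift G x z)"
    have \<zeta>: "?\<zeta> \<in> states G" "(x, \<mu> + shift G y z) \<in> states G"
      using shifted_states \<xi> pop_pos z by auto
    show "\<bar>rate1 G ?\<zeta> $ y * (\<beta> t ?\<zeta> - \<beta>' t ?\<zeta>) $ y\<bar> \<le> \<Lambda> * b"
      unfolding abs_mult
      by (intro mult_mono order_trans[OF component_le_norm_cart] rate1_bound b \<zeta> Lambda_nonneg) auto
    show "\<bar>\<phi> (x, \<mu> + shift G y z) - \<phi> (x, \<mu>)\<bar> \<le> 2 * M"
      using M[OF \<zeta>(2)] M[OF \<xi>] by simp
  qed (use \<xi> \<open>0 \<le> b\<close> \<open>0 \<le> M\<close> in auto)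
  finally show ?thesis .
qed

lemma continuous_on_gen_mu:
  assumes \<xi>: "\<xi> \<in> states G" and \<beta>: "\<And>\<zeta>. \<zeta> \<in> states G \<Longrightarrow> continuous_on A (\<lambda>t. \<beta> t \<zeta>)"
    and u: "\<And>\<eta>. \<eta> \<in> states G \<Longrightarrow> continuous_on A (\<lambda>t. u t \<eta>)"
  shows "continuous_on A (\<lambda>t. gen_mu G \<beta> (u t) t \<xi>)"
proof -
  obtain x \<mu> where [simp]: "\<xi> = (x, \<mu>)" by (cases \<xi>)
  have "continuous_on A (\<lambda>t. real (pop G) * \<mu> $ z
        * (rate0 G (z, \<mu> + shift G x z) $ y
           + rate1 G (z, \<mu> + shift G x z) $ y * \<beta> t (z, \<mu> + shift G x z) $ y)
        * (u t (x, \<mu> + shift G y z) - u t (x, \<mu>)))" for y z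
  proof (cases "\<mu> $ z = 0")
    case False
    then have "(z, \<mu> + shift G x z) \<in> states G" "(x, \<mu> + shift G y z) \<in> states G"
      using shifted_states \<xi> pop_pos by auto
    then show ?thesis
      using \<xi> by (intro continuous_intros \<beta> u) auto
  qed simp
  then show ?thesis
    by (auto simp: case_prod_unfold intro!: continuous_on_sum)
qed

lemma continuous_on_opt_in:
  assumes \<xi>: "\<xi> \<in> states G" and K: "admissible (fst \<xi>) K" and p: "continuous_on A p"
  shows "continuous_on A (\<lambda>t. opt_in K G \<xi> (p t))"
proof -
  have "(C / \<gamma>)-lipschitz_on UNIV (opt_in K G \<xi>)"
    using opt_in_lipschitz[OF \<xi> K] C_nonneg gamma_pos by (intro lipschitz_onI) (auto simp: dist_norm)
  from continuous_on_compose2[OF lipschitz_on_continuous_on[OF this] p] show ?thesis by simp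
qed

lemma continuous_on_pre_hamiltonian:
  assumes \<xi>: "\<xi> \<in> states G" and p: "continuous_on A p" and a: "continuous_on A a"
    and rates: "\<And>t. t \<in> A \<Longrightarrow> a t \<in> rates (fst \<xi>)"
  shows "continuous_on A (\<lambda>t. pre_hamiltonian G \<xi> (p t) (a t))"
  unfolding pre_hamiltonian_def
  using rates by (intro continuous_intros p a continuous_on_compose2[OF run_cost_cont[OF \<xi>] a]) auto

text \<open>A continuous time derivative is bounded on the compact interval, so \<open>w\<close> is
  Lipschitz in time; differences in \<open>x\<close> and the minimiser preserve this.\<close>

lemma feedback_control:
  assumes w: "\<And>t \<eta>. t \<in> {0..horizon G} \<Longrightarrow> \<eta> \<in> states G \<Longrightarrow>
        ((\<lambda>t. w t \<eta>) has_real_derivative w' t \<eta>) (at t within {0..horizon G})"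
    and w': "\<And>\<eta>. \<eta> \<in> states G \<Longrightarrow> continuous_on {0..horizon G} (\<lambda>t. w' t \<eta>)"
    and K: "\<And>\<xi>. \<xi> \<in> states G \<Longrightarrow> admissible (fst \<xi>) (K \<xi>)"
  shows "(\<lambda>t \<xi>. opt_in (K \<xi>) G \<xi> (diff_x (w t) \<xi>)) \<in> controls G"
proof -
  obtain B where B: "0 \<le> B" "\<And>t \<eta>. t \<in> {0..horizon G} \<Longrightarrow> \<eta> \<in> states G \<Longrightarrow> norm (w' t \<eta>) \<le> B"
    using continuous_family_bounded[OF finite_states[of G], of 0 "horizon G" w'] w' by blast
  have wlip: "\<bar>w s \<eta> - w t \<eta>\<bar> \<le> B * \<bar>s - t\<bar>"
    if "s \<in> {0..horizon G}" "t \<in> {0..horizon G}" "\<eta> \<in> states G" for s t \<eta>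
    using field_differentiable_bound[OF _ w[OF _ that(3)] B(2)[OF _ that(3)] that(1,2)] by simp
  define L where "L = C / \<gamma> * (2 * real CARD('d) * B)"
  have "L-lipschitz_on {0..horizon G} (\<lambda>t. opt_in (K \<xi>) G \<xi> (diff_x (w t) \<xi>))" if \<xi>: "\<xi> \<in> states G" for \<xi>
  proof (rule lipschitz_onI)
    fix s t assume st: "s \<in> {0..horizon G}" "t \<in> {0..horizon G}"
    have "norm (opt_in (K \<xi>) G \<xi> (diff_x (w s) \<xi>) - opt_in (K \<xi>) G \<xi> (diff_x (w t) \<xi>))
        \<le> C / \<gamma> * norm (diff_x (w s) \<xi> - diff_x (w t) \<xi>)"
      by (rule opt_in_lipschitz[OF \<xi> K[OF \<xi>]])
    also have "\<dots> \<le> C / \<gamma> * (2 * real CARD('d) * (B * \<bar>s - t\<bar>))"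
      using C_nonneg gamma_pos by (intro mult_left_mono norm_diff_x_diff_le[OF \<xi>] wlip st) auto
    finally show "dist (opt_in (K \<xi>) G \<xi> (diff_x (w s) \<xi>)) (opt_in (K \<xi>) G \<xi> (diff_x (w t) \<xi>)) \<le> L * dist s t"
      by (simp add: L_def dist_norm mult_ac)
  qed (use B C_nonneg gamma_pos in \<open>auto simp: L_def\<close>)
  moreover have "opt_in (K \<xi>) G \<xi> p \<in> rates (fst \<xi>)" if "\<xi> \<in> states G" for \<xi> p
    using opt_in_mem[OF that K[OF that]] admissibleD(1)[OF K[OF that]] by blast
  ultimately show ?thesis
    unfolding controls_def by blast
qed

end

section \<open>Verification for the control problem against a fixed population control\<close>

locale mean_field_game = strongly_convex_game G \<gamma> \<Lambda>
  for G :: "'d::finite game" and \<gamma> \<Lambda> +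
  fixes P :: "('d, 'w) laws" and \<Xi> :: "real \<Rightarrow> 'w \<Rightarrow> 'd state"
  assumes process: "game_process G P \<Xi>"
begin

abbreviation T where "T \<equiv> horizon G"
abbreviation S where "S \<equiv> states G"
abbreviation J where "J t \<xi> \<alpha> \<beta> \<equiv> cost G P \<Xi> t \<xi> \<alpha> \<beta>"

text \<open>Each comparison concerns one given control. A function that is a subsolution for every
  control and a supersolution for one of them is thereby squeezed onto the infimum, and that control
  is optimal.\<close>

lemma
  assumes \<alpha>: "\<alpha> \<in> controls G" and \<beta>: "\<beta> \<in> controls G" and t: "t \<in> {0..T}" and \<xi>: "\<xi> \<in> S"
    and w: "\<And>u \<eta>. u \<in> {0..T} \<Longrightarrow> \<eta> \<in> S \<Longrightarrow> ((\<lambda>u. w u \<eta>) has_real_derivative w' u \<eta>) (at u within {0..T})"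
  shows subsolution_le_cost: "(\<And>\<eta>. \<eta> \<in> S \<Longrightarrow> w T \<eta> \<le> term_cost G \<eta>) \<Longrightarrow>
      (\<And>u \<eta>. u \<in> {0..T} \<Longrightarrow> \<eta> \<in> S \<Longrightarrow>
        0 \<le> w' u \<eta> + pre_hamiltonian G \<eta> (diff_x (w u) \<eta>) (\<alpha> u \<eta>) + gen_mu G \<beta> (w u) u \<eta>) \<Longrightarrow> w t \<xi> \<le> J t \<xi> \<alpha> \<beta>"
    and cost_le_supersolution: "(\<And>\<eta>. \<eta> \<in> S \<Longrightarrow> term_cost G \<eta> \<le> w T \<eta>) \<Longrightarrow>
      (\<And>u \<eta>. u \<in> {0..T} \<Longrightarrow> \<eta> \<in> S \<Longrightarrow>
        w' u \<eta> + pre_hamiltonian G \<eta> (diff_x (w u) \<eta>) (\<alpha> u \<eta>) + gen_mu G \<beta> (w u) u \<eta> \<le> 0) \<Longrightarrow> J t \<xi> \<alpha> \<beta> \<le> w t \<xi>"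
proof -
  have chain: "markov_chain S T (\<lambda>\<phi> u \<zeta>. gen_x G \<alpha> \<phi> u \<zeta> + gen_mu G \<beta> \<phi> u \<zeta>) t \<xi> (P \<alpha> \<beta> t \<xi>) \<Xi>"
    using process \<alpha> \<beta> t \<xi> by (auto simp: game_process_def)
  have f: "continuous_on {0..T} (\<lambda>u. run_cost G \<eta> (\<alpha> u \<eta>))" if "\<eta> \<in> S" for \<eta>
    using controls_rates[OF \<alpha> _ that]
    by (intro continuous_on_compose2[OF run_cost_cont[OF that] controls_continuous[OF \<alpha> that]]) auto
  have split: "w' u \<eta> + (gen_x G \<alpha> (w u) u \<eta> + gen_mu G \<beta> (w u) u \<eta>) + run_cost G \<eta> (\<alpha> u \<eta>)
      = w' u \<eta> + pre_hamiltonian G \<eta> (diff_x (w u) \<eta>) (\<alpha> u \<eta>) + gen_mu G \<beta> (w u) u \<eta>" for u \<eta>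
    unfolding run_cost_plus_gen_x[symmetric] by simp
  have t': "0 \<le> t" "t \<le> T" using t by auto
  show "w t \<xi> \<le> J t \<xi> \<alpha> \<beta>"
    if "\<And>\<eta>. \<eta> \<in> S \<Longrightarrow> w T \<eta> \<le> term_cost G \<eta>"
      "\<And>u \<eta>. u \<in> {0..T} \<Longrightarrow> \<eta> \<in> S \<Longrightarrow>
        0 \<le> w' u \<eta> + pre_hamiltonian G \<eta> (diff_x (w u) \<eta>) (\<alpha> u \<eta>) + gen_mu G \<beta> (w u) u \<eta>"
    unfolding cost_def
    by (rule subsolution_le[OF finite_states \<xi> chain t', where w = w and w' = w'
          and f = "\<lambda>u \<eta>. run_cost G \<eta> (\<alpha> u \<eta>)"], unfold split) (fact f w that)+
  show "J t \<xi> \<alpha> \<beta> \<le> w t \<xi>"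
    if "\<And>\<eta>. \<eta> \<in> S \<Longrightarrow> term_cost G \<eta> \<le> w T \<eta>"
      "\<And>u \<eta>. u \<in> {0..T} \<Longrightarrow> \<eta> \<in> S \<Longrightarrow>
        w' u \<eta> + pre_hamiltonian G \<eta> (diff_x (w u) \<eta>) (\<alpha> u \<eta>) + gen_mu G \<beta> (w u) u \<eta> \<le> 0"
    unfolding cost_def
    by (rule supersolution_ge[OF finite_states \<xi> chain t', where w = w and w' = w'
          and f = "\<lambda>u \<eta>. run_cost G \<eta> (\<alpha> u \<eta>)"], unfold split) (fact f w that)+
qed

lemma cost_nonneg:
  assumes \<alpha>: "\<alpha> \<in> controls G" and \<beta>: "\<beta> \<in> controls G" and t: "t \<in> {0..T}" and \<xi>: "\<xi> \<in> S"
  shows "0 \<le> J t \<xi> \<alpha> \<beta>"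
proof (rule subsolution_le_cost[OF \<alpha> \<beta> t \<xi>, where w = "\<lambda>_ _. 0" and w' = "\<lambda>_ _. 0"])
  fix u \<eta> assume u: "u \<in> {0..T}" and \<eta>: "\<eta> \<in> S"
  show "0 \<le> 0 + pre_hamiltonian G \<eta> (diff_x (\<lambda>_. 0) \<eta>) (\<alpha> u \<eta>) + gen_mu G \<beta> (\<lambda>_. 0) u \<eta>"
    unfolding run_cost_plus_gen_x[symmetric] using run_cost_nonneg[OF \<eta> controls_rates[OF \<alpha> u \<eta>]] by simp
qed (auto simp: term_cost_nonneg)

text \<open>Both generators annihilate functions of time alone, so an affine function of slope
  \<open>- \<Lambda>\<close> absorbs the running cost at rate 0.\<close>

lemma cost_zero_control_le:
  assumes \<beta>: "\<beta> \<in> controls G" and t: "t \<in> {0..T}" and \<xi>: "\<xi> \<in> S"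
  shows "J t \<xi> (\<lambda>_ _. 0) \<beta> \<le> \<Lambda> + \<Lambda> * (T - t)"
proof (rule cost_le_supersolution[OF zero_control \<beta> t \<xi>, where w = "\<lambda>u _. \<Lambda> + \<Lambda> * (T - u)" and w' = "\<lambda>_ _. - \<Lambda>"])
  fix u \<eta> assume u: "u \<in> {0..T}" and \<eta>: "\<eta> \<in> S"
  show "- \<Lambda> + pre_hamiltonian G \<eta> (diff_x (\<lambda>_. \<Lambda> + \<Lambda> * (T - u)) \<eta>) 0 + gen_mu G \<beta> (\<lambda>_. \<Lambda> + \<Lambda> * (T - u)) u \<eta> \<le> 0"
    using run_cost_plus_gen_x[of G \<eta> "\<lambda>_ _. 0" u "\<lambda>_. \<Lambda> + \<Lambda> * (T - u)"] run_cost_0[OF \<eta>] by simp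
qed (auto simp: term_cost_bound intro!: derivative_eq_intros)

text \<open>
  The equation for the value function is solved with the rates truncated to a ball, which makes the
  Hamiltonian Lipschitz. The solution, being squeezed between \<open>0\<close> and the cost of the zero control, has an
  optimal rate inside the ball, so it solves the untruncated equation too.
\<close>

lemma hjb_solution:
  assumes \<beta>: "\<beta> \<in> controls G"
  obtains \<alpha> w where "\<alpha> \<in> controls G"
    "\<And>t \<xi>. t \<in> {0..T} \<Longrightarrow> \<xi> \<in> S \<Longrightarrow> \<alpha> t \<xi> = opt_rate G \<xi> (diff_x (w t) \<xi>)"
    "\<And>t \<xi>. t \<in> {0..T} \<Longrightarrow> \<xi> \<in> S \<Longrightarrow> best_value G P \<Xi> \<beta> t \<xi> = w t \<xi>"
proof -
  \<comment> \<open>Anticipates \<open>w_bounds\<close>: values between \<open>0\<close> and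
    \<open>\<Lambda> + \<Lambda> * T\<close> force \<open>norm (diff_x (w t) \<xi>) \<le> M\<close>,
    and then \<open>radius M\<close> is large enough for the truncation to be inactive.\<close>
  define M where "M = 2 * real CARD('d) * (\<Lambda> + \<Lambda> * T)"
  have M: "0 \<le> M" using Lambda_nonneg horizon_pos by (simp add: M_def)
  define R where "R = radius M"
  have R: "0 \<le> R" using radius_pos[OF M] by (simp add: R_def)
  define K where "K \<xi> = rates (fst \<xi>) \<inter> cball 0 R" for \<xi> :: "'d state"
  have K: "admissible (fst \<xi>) (K \<xi>)" for \<xi> using R by (simp add: K_def)
  define F where "F t \<phi> \<xi> = pre_hamiltonian G \<xi> (diff_x \<phi> \<xi>) (opt_in (K \<xi>) G \<xi> (diff_x \<phi> \<xi>)) + gen_mu G \<beta> \<phi> t \<xi>"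
    for t \<phi> \<xi>
  have contF: "continuous_on {0..T} (\<lambda>t. F t (u t) \<xi>)"
    if \<xi>: "\<xi> \<in> S" and u: "\<And>\<eta>. \<eta> \<in> S \<Longrightarrow> continuous_on {0..T} (\<lambda>t. u t \<eta>)" for u \<xi>
    unfolding F_def
    using opt_in_mem[OF \<xi> K] admissibleD(1)[OF K, of \<xi>] \<xi>
    by (intro continuous_on_add continuous_on_pre_hamiltonian continuous_on_opt_in continuous_on_diff_x
        continuous_on_gen_mu controls_continuous \<beta> \<xi> K u) auto
  obtain B where B: "0 \<le> B" "\<And>t \<eta>. t \<in> {0..T} \<Longrightarrow> \<eta> \<in> S \<Longrightarrow> norm (\<beta> t \<eta>) \<le> B"
    using continuous_family_bounded[OF finite_states[of G], of 0 T \<beta>] controls_continuous[OF \<beta>] by blast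
  define L where "L = C * (1 + R) * (2 * real CARD('d)) + D * (1 + B)"
  have "0 \<le> L" using C_nonneg D_nonneg R B by (simp add: L_def)
  have lip: "\<bar>F t u \<xi> - F t w \<xi>\<bar> \<le> L * (\<Sum>\<eta>\<in>S. \<bar>u \<eta> - w \<eta>\<bar>)" if t: "t \<in> {0..T}" and \<xi>: "\<xi> \<in> S" for t u w \<xi>
  proof -
    let ?e = "\<Sum>\<eta>\<in>S. \<bar>u \<eta> - w \<eta>\<bar>"
    have e: "\<bar>u \<eta> - w \<eta>\<bar> \<le> ?e" if "\<eta> \<in> S" for \<eta>
      using that finite_states by (intro member_le_sum[of \<eta> S "\<lambda>\<eta>. \<bar>u \<eta> - w \<eta>\<bar>"]) auto
    have "\<bar>pre_hamiltonian G \<xi> (diff_x u \<xi>) (opt_in (K \<xi>) G \<xi> (diff_x u \<xi>))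
        - pre_hamiltonian G \<xi> (diff_x w \<xi>) (opt_in (K \<xi>) G \<xi> (diff_x w \<xi>))\<bar>
        \<le> C * (1 + R) * norm (diff_x u \<xi> - diff_x w \<xi>)"
      unfolding K_def by (rule truncated_hamiltonian_lipschitz[OF \<xi> R])
    also have "\<dots> \<le> C * (1 + R) * (2 * real CARD('d) * ?e)"
      using C_nonneg R by (intro mult_left_mono norm_diff_x_diff_le[OF \<xi> e]) auto
    finally have 1: "\<bar>pre_hamiltonian G \<xi> (diff_x u \<xi>) (opt_in (K \<xi>) G \<xi> (diff_x u \<xi>))
        - pre_hamiltonian G \<xi> (diff_x w \<xi>) (opt_in (K \<xi>) G \<xi> (diff_x w \<xi>))\<bar> \<le> C * (1 + R) * (2 * real CARD('d) * ?e)" .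
    have 2: "\<bar>gen_mu G \<beta> u t \<xi> - gen_mu G \<beta> w t \<xi>\<bar> \<le> D * ((1 + B) * ?e)"
      using B t by (intro gen_mu_diff_phi_le[OF \<xi> _ _ e]) auto
    have "L * ?e = C * (1 + R) * (2 * real CARD('d) * ?e) + D * ((1 + B) * ?e)"
      unfolding L_def by (simp only: distrib_right mult.assoc)
    with 1 2 show ?thesis unfolding F_def by linarith
  qed
  have "0 \<le> T" using horizon_pos by simp
  have "\<exists>w. (\<forall>\<xi>\<in>S. w T \<xi> = term_cost G \<xi>) \<and> (\<forall>t\<in>{0..T}. \<forall>\<xi>\<in>S.
      ((\<lambda>t. w t \<xi>) has_real_derivative - F t (w t) \<xi>) (at t within {0..T}))"
    by (rule backward_ode_exists[OF finite_states[of G] \<open>0 \<le> T\<close> \<open>0 \<le> L\<close>, where F = F and g = "term_cost G"])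
       (use contF lip in blast)+
  then obtain w where wT: "\<And>\<xi>. \<xi> \<in> S \<Longrightarrow> w T \<xi> = term_cost G \<xi>"
    and w: "\<And>t \<xi>. t \<in> {0..T} \<Longrightarrow> \<xi> \<in> S \<Longrightarrow>
       ((\<lambda>t. w t \<xi>) has_real_derivative - F t (w t) \<xi>) (at t within {0..T})"
    by blast
  define \<alpha> where "\<alpha> t \<xi> = opt_in (K \<xi>) G \<xi> (diff_x (w t) \<xi>)" for t \<xi>
  have \<alpha>: "\<alpha> \<in> controls G"
    unfolding \<alpha>_def[abs_def]
    by (rule feedback_control[OF w _ K]) (auto intro!: continuous_on_minus contF DERIV_continuous_on[OF w])
  have F: "F t (w t) \<xi> = pre_hamiltonian G \<xi> (diff_x (w t) \<xi>) (\<alpha> t \<xi>) + gen_mu G \<beta> (w t) t \<xi>" for t \<xi>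
    by (simp add: F_def \<alpha>_def)
  have J\<alpha>: "J t \<xi> \<alpha> \<beta> \<le> w t \<xi>" if "t \<in> {0..T}" "\<xi> \<in> S" for t \<xi>
    by (rule cost_le_supersolution[OF \<alpha> \<beta> that w]) (auto simp: wT F)
  have w_bounds: "0 \<le> w t \<xi>" "w t \<xi> \<le> \<Lambda> + \<Lambda> * T" if t: "t \<in> {0..T}" and \<xi>: "\<xi> \<in> S" for t \<xi>
  proof -
    show "0 \<le> w t \<xi>" using cost_nonneg[OF \<alpha> \<beta> t \<xi>] J\<alpha>[OF t \<xi>] by linarith
    \<comment> \<open>The rate 0 lies in the truncating ball, so already the truncated solution is a
      subsolution for the zero control. There is thus no circularity in using its bounds to remove
      the truncation.\<close>
    have "w t \<xi> \<le> J t \<xi> (\<lambda>_ _. 0) \<beta>"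
    proof (rule subsolution_le_cost[OF zero_control \<beta> t \<xi> w])
      fix u \<eta> assume "u \<in> {0..T}" "\<eta> \<in> S"
      then show "0 \<le> - F u (w u) \<eta> + pre_hamiltonian G \<eta> (diff_x (w u) \<eta>) 0 + gen_mu G \<beta> (w u) u \<eta>"
        using opt_in_le[OF \<open>\<eta> \<in> S\<close> K admissibleD(3)[OF K]] by (simp add: F_def)
    qed (auto simp: wT)
    also have "\<dots> \<le> \<Lambda> + \<Lambda> * (T - t)" by (rule cost_zero_control_le[OF \<beta> t \<xi>])
    also have "\<dots> \<le> \<Lambda> + \<Lambda> * T" using t Lambda_nonneg by (simp add: mult_left_mono)
    finally show "w t \<xi> \<le> \<Lambda> + \<Lambda> * T" .
  qed
  have opt: "\<alpha> t \<xi> = opt_rate G \<xi> (diff_x (w t) \<xi>)" if t: "t \<in> {0..T}" and \<xi>: "\<xi> \<in> S" for t \<xi>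
  proof -
    have "norm (diff_x (w t) \<xi> - diff_x (\<lambda>_. 0) \<xi>) \<le> M"
      unfolding M_def using w_bounds[OF t] by (intro norm_diff_x_diff_le[OF \<xi>]) auto
    moreover have "diff_x (\<lambda>_. 0) \<xi> = 0" by (cases \<xi>) (simp add: vec_eq_iff)
    ultimately show ?thesis
      unfolding \<alpha>_def K_def R_def by (intro opt_in_truncated[OF \<xi> _ M order_refl]) simp
  qed
  show thesis
  proof (rule that[OF \<alpha> opt])
    fix t \<xi> assume t: "t \<in> {0..T}" and \<xi>: "\<xi> \<in> S"
    \<comment> \<open>By \<open>opt\<close> the rate \<open>\<alpha>\<close> minimises over all
      rates rather than over the ball, so \<open>w\<close> is a subsolution for every control,
      however large.\<close>
    have le: "w t \<xi> \<le> J t \<xi> a \<beta>" if a: "a \<in> controls G" for a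
    proof (rule subsolution_le_cost[OF a \<beta> t \<xi> w])
      fix u \<eta> assume "u \<in> {0..T}" "\<eta> \<in> S"
      then show "0 \<le> - F u (w u) \<eta> + pre_hamiltonian G \<eta> (diff_x (w u) \<eta>) (a u \<eta>) + gen_mu G \<beta> (w u) u \<eta>"
        using opt_in_le[OF \<open>\<eta> \<in> S\<close> admissible_rates controls_rates[OF a]]
        by (simp add: F opt opt_rate_eq_opt_in)
    qed (auto simp: wT)
    show "best_value G P \<Xi> \<beta> t \<xi> = w t \<xi>"
      unfolding best_value_def
    proof (rule cInf_eq_minimum)
      have "w t \<xi> = J t \<xi> \<alpha> \<beta>" using le[OF \<alpha>] J\<alpha>[OF t \<xi>] by simp
      then show "w t \<xi> \<in> (\<lambda>a. J t \<xi> a \<beta>) ` controls G" using \<alpha> by blast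
    qed (use le in auto)
  qed
qed

lemma best_response_control:
  assumes "\<beta> \<in> controls G"
  shows "best_response G P \<Xi> \<beta> \<in> controls G"
proof -
  obtain \<alpha> w where \<alpha>: "\<alpha> \<in> controls G"
    and opt: "\<And>t \<xi>. t \<in> {0..T} \<Longrightarrow> \<xi> \<in> S \<Longrightarrow> \<alpha> t \<xi> = opt_rate G \<xi> (diff_x (w t) \<xi>)"
    and w: "\<And>t \<xi>. t \<in> {0..T} \<Longrightarrow> \<xi> \<in> S \<Longrightarrow> best_value G P \<Xi> \<beta> t \<xi> = w t \<xi>"
    using hjb_solution[OF assms] by metis
  show ?thesis
  proof (rule controls_cong[OF \<alpha>])
    fix t \<xi> assume t: "t \<in> {0..T}" and \<xi>: "\<xi> \<in> S"
    show "best_response G P \<Xi> \<beta> t \<xi> = \<alpha> t \<xi>"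
      using diff_x_cong[OF \<xi> w[OF t]] opt[OF t \<xi>] by (simp add: best_response_def)
  qed
qed

lemma beta_iter_control:
  assumes "\<beta>0 \<in> controls G" "0 \<le> \<rho>" "\<rho> \<le> 1"
  shows "beta_iter G P \<Xi> \<rho> \<beta>0 n \<in> controls G"
  by (induction n) (auto intro!: controls_convex_combination best_response_control assms)

end

section \<open>Stability around the equilibrium and convergence of the iteration\<close>

locale mean_field_equilibrium = mean_field_game G \<gamma> \<Lambda> P \<Xi>
  for G :: "'d::finite game" and \<gamma> \<Lambda> and P :: "('d, 'w) laws" and \<Xi> :: "real \<Rightarrow> 'w \<Rightarrow> 'd state" +
  fixes v :: "real \<Rightarrow> 'd state \<Rightarrow> real"
  assumes NLL: "NLL_solution G v"
begin

definition eq_control :: "'d control" where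
  "eq_control t \<xi> = opt_rate G \<xi> (diff_x (v t) \<xi>)"

lemma v_terminal: "\<xi> \<in> S \<Longrightarrow> v T \<xi> = term_cost G \<xi>"
  using NLL by (auto simp: NLL_solution_def)

lemma v_deriv:
  assumes "t \<in> {0..T}" "\<xi> \<in> S"
  shows "((\<lambda>t. v t \<xi>) has_real_derivative
      - (pre_hamiltonian G \<xi> (diff_x (v t) \<xi>) (eq_control t \<xi>) + gen_mu G eq_control (v t) t \<xi>)) (at t within {0..T})"
  using NLL assms by (auto simp: NLL_solution_def eq_control_def[abs_def] hamiltonian_eq)

lemma v_continuous: "\<xi> \<in> S \<Longrightarrow> continuous_on {0..T} (\<lambda>t. v t \<xi>)"
  by (rule DERIV_continuous_on, rule v_deriv)

lemma eq_control_control: "eq_control \<in> controls G"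
proof -
  \<comment> \<open>The derivative of \<open>v\<close> contains this feedback, so its continuity,
    inherited from \<open>v\<close>, must come before the Lipschitz property, which rests on a
    continuous derivative.\<close>
  have cont: "continuous_on {0..T} (\<lambda>t. eq_control t \<xi>)" if "\<xi> \<in> S" for \<xi>
    unfolding eq_control_def opt_rate_eq_opt_in
    by (intro continuous_on_opt_in[OF that admissible_rates] continuous_on_diff_x[OF that] v_continuous)
  have rates: "eq_control t \<xi> \<in> rates (fst \<xi>)" if "\<xi> \<in> S" for t \<xi>
    using opt_in_mem[OF that admissible_rates] by (simp add: eq_control_def opt_rate_eq_opt_in)
  have "(\<lambda>t \<xi>. opt_in (rates (fst \<xi>)) G \<xi> (diff_x (v t) \<xi>)) \<in> controls G"
    by (rule feedback_control[OF v_deriv])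
       (auto intro!: continuous_intros continuous_on_pre_hamiltonian continuous_on_gen_mu
          continuous_on_diff_x v_continuous cont rates)
  then show ?thesis
    by (simp add: eq_control_def[abs_def] opt_rate_eq_opt_in)
qed

text \<open>
  \<open>v \<plusminus> K B exp (\<theta> (T - t)) / \<theta>\<close> are a super- and a subsolution for the control problem against \<open>\<beta>\<close>.
\<close>

lemma best_value_stability:
  assumes M: "\<And>u \<eta>. u \<in> {0..T} \<Longrightarrow> \<eta> \<in> S \<Longrightarrow> \<bar>v u \<eta>\<bar> \<le> M"
    and \<beta>: "\<beta> \<in> controls G" and \<theta>: "0 < \<theta>"
    and le: "\<And>u \<zeta>. u \<in> {0..T} \<Longrightarrow> \<zeta> \<in> S \<Longrightarrow> norm (\<beta> u \<zeta> - eq_control u \<zeta>) \<le> B * exp (\<theta> * (T - u))"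
    and t: "t \<in> {0..T}" and \<xi>: "\<xi> \<in> S"
  shows "\<bar>best_value G P \<Xi> \<beta> t \<xi> - v t \<xi>\<bar> \<le> D * M * B / \<theta> * exp (\<theta> * (T - t))"
proof -
  have "0 \<le> M" using M[OF t \<xi>] by linarith
  \<comment> \<open>Being constant over the states, \<open>c u\<close> changes neither
    \<open>diff_x\<close> nor \<open>gen_mu\<close>; only its time derivative
    \<open>- \<theta> * c u\<close> counts. The prefactor makes \<open>\<theta> * c u\<close> equal
    to the error of replacing the equilibrium control by \<open>\<beta>\<close> in
    \<open>gen_mu\<close>.\<close>
  define c where "c u = D * M * B / \<theta> * exp (\<theta> * (T - u))" for u
  have "0 \<le> B * exp (\<theta> * (T - t))" by (rule order_trans[OF norm_ge_zero le[OF t \<xi>]])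
  then have "0 \<le> B" by (simp add: zero_le_mult_iff)
  then have c: "0 \<le> c u" for u using \<theta> D_nonneg \<open>0 \<le> M\<close> by (simp add: c_def)
  have c': "(c has_real_derivative - (\<theta> * c u)) (at u within A)" for u A
    unfolding c_def[abs_def] by (auto intro!: derivative_eq_intros)
  have mu: "\<bar>gen_mu G \<beta> (v u) u \<eta> - gen_mu G eq_control (v u) u \<eta>\<bar> \<le> \<theta> * c u"
    if u: "u \<in> {0..T}" and \<eta>: "\<eta> \<in> S" for u \<eta>
  proof -
    have "\<bar>gen_mu G \<beta> (v u) u \<eta> - gen_mu G eq_control (v u) u \<eta>\<bar> \<le> D * (B * exp (\<theta> * (T - u)) * M)"
      using M[OF u] by (intro gen_mu_diff_beta_le[OF \<eta>] le u) auto
    also have "\<dots> = \<theta> * c u" using \<theta> by (simp add: c_def)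
    finally show ?thesis .
  qed
  let ?H = "\<lambda>u \<eta>. pre_hamiltonian G \<eta> (diff_x (v u) \<eta>) (eq_control u \<eta>) + gen_mu G eq_control (v u) u \<eta>"
  have lower: "v t \<xi> - c t \<le> J t \<xi> a \<beta>" if a: "a \<in> controls G" for a
  proof -
    have "v t \<xi> + - c t \<le> J t \<xi> a \<beta>"
    proof (rule subsolution_le_cost[OF a \<beta> t \<xi>, where w = "\<lambda>u \<eta>. v u \<eta> + - c u" and w' = "\<lambda>u \<eta>. - ?H u \<eta> + \<theta> * c u"])
      fix u \<eta> assume u: "u \<in> {0..T}" and \<eta>: "\<eta> \<in> S"
      show "((\<lambda>u. v u \<eta> + - c u) has_real_derivative - ?H u \<eta> + \<theta> * c u) (at u within {0..T})"
        using DERIV_add[OF v_deriv[OF u \<eta>] DERIV_minus[OF c']] by simp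
      have "pre_hamiltonian G \<eta> (diff_x (v u) \<eta>) (eq_control u \<eta>) \<le> pre_hamiltonian G \<eta> (diff_x (v u) \<eta>) (a u \<eta>)"
        using opt_in_le[OF \<eta> admissible_rates controls_rates[OF a u \<eta>]]
        by (simp add: eq_control_def opt_rate_eq_opt_in)
      with mu[OF u \<eta>] show "0 \<le> - ?H u \<eta> + \<theta> * c u
          + pre_hamiltonian G \<eta> (diff_x (\<lambda>\<eta>. v u \<eta> + - c u) \<eta>) (a u \<eta>) + gen_mu G \<beta> (\<lambda>\<eta>. v u \<eta> + - c u) u \<eta>"
        unfolding diff_x_add_const gen_mu_add_const by linarith
    qed (use c in \<open>auto simp: v_terminal\<close>)
    then show ?thesis by simp
  qed
  \<comment> \<open>Playing the equilibrium control against \<open>\<beta>\<close> need not be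
    optimal, but its cost bounds the infimum from above.\<close>
  have upper: "J t \<xi> eq_control \<beta> \<le> v t \<xi> + c t"
  proof (rule cost_le_supersolution[OF eq_control_control \<beta> t \<xi>, where w = "\<lambda>u \<eta>. v u \<eta> + c u" and w' = "\<lambda>u \<eta>. - ?H u \<eta> + - (\<theta> * c u)"])
    fix u \<eta> assume u: "u \<in> {0..T}" and \<eta>: "\<eta> \<in> S"
    show "((\<lambda>u. v u \<eta> + c u) has_real_derivative - ?H u \<eta> + - (\<theta> * c u)) (at u within {0..T})"
      using DERIV_add[OF v_deriv[OF u \<eta>] c'] by simp
    show "- ?H u \<eta> + - (\<theta> * c u) + pre_hamiltonian G \<eta> (diff_x (\<lambda>\<eta>. v u \<eta> + c u) \<eta>) (eq_control u \<eta>)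
        + gen_mu G \<beta> (\<lambda>\<eta>. v u \<eta> + c u) u \<eta> \<le> 0"
      using mu[OF u \<eta>] unfolding diff_x_add_const gen_mu_add_const by linarith
  qed (use c in \<open>auto simp: v_terminal\<close>)
  \<comment> \<open>An infimum of reals lies below its members only once the set is known to be
    bounded below; \<open>lower\<close> provides this.\<close>
  have "bdd_below ((\<lambda>a. J t \<xi> a \<beta>) ` controls G)"
    using lower by (auto intro!: bdd_belowI)
  then have "best_value G P \<Xi> \<beta> t \<xi> \<le> J t \<xi> eq_control \<beta>"
    unfolding best_value_def by (rule cINF_lower[OF _ eq_control_control])
  moreover have "v t \<xi> - c t \<le> best_value G P \<Xi> \<beta> t \<xi>"
    unfolding best_value_def using eq_control_control lower by (intro cINF_greatest) auto
  ultimately show "\<bar>best_value G P \<Xi> \<beta> t \<xi> - v t \<xi>\<bar> \<le> D * M * B / \<theta> * exp (\<theta> * (T - t))"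
    using upper unfolding c_def[symmetric] abs_le_iff by linarith
qed

text \<open>The price of a rate close to \<open>\<rho>\<close> sits in \<open>c\<close>: unweighting
  costs a factor \<open>exp (\<theta> * T)\<close>, and the chosen \<open>\<theta>\<close> grows
  without bound as \<open>q\<close> approaches \<open>\<rho>\<close>.\<close>

lemma v_iter_convergence:
  assumes \<beta>0: "\<beta>0 \<in> controls G" and \<rho>: "0 \<le> \<rho>" "\<rho> < 1" and q: "\<rho> < q"
  shows "\<exists>c>0. \<forall>n\<ge>1. \<forall>t\<in>{0..T}. state_norm G (\<lambda>\<xi>. v_iter G P \<Xi> \<rho> \<beta>0 n t \<xi> - v t \<xi>) \<le> c * q ^ n"
proof -
  obtain M where M: "0 \<le> M" "\<And>t \<eta>. t \<in> {0..T} \<Longrightarrow> \<eta> \<in> S \<Longrightarrow> \<bar>v t \<eta>\<bar> \<le> M"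
    using continuous_family_bounded[OF finite_states[of G], of 0 T v] v_continuous
    unfolding real_norm_def by blast
  define K where "K = D * M"
  have K: "0 \<le> K" using M(1) D_nonneg by (simp add: K_def)
  note stab = best_value_stability[OF M(2), folded K_def]
  \<comment> \<open>Up to \<open>1 / \<theta>\<close>, the factor from the deviation of the
    population to that of the best response: stability of the value, passage to differences in
    \<open>x\<close>, Lipschitz constant of the minimiser.\<close>
  define K' where "K' = C / \<gamma> * (2 * real CARD('d)) * K"
  have K': "0 \<le> K'" using K C_nonneg gamma_pos by (simp add: K'_def)
  \<comment> \<open>Chosen to give \<open>K' / \<theta> \<le> q - \<rho>\<close>; the added 1 keeps
    \<open>\<theta>\<close> positive when \<open>K'\<close> vanishes.\<close>
  define \<theta> where "\<theta> = (K' + 1) / (q - \<rho>)"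
  have \<theta>: "0 < \<theta>" using K' q by (simp add: \<theta>_def)
  have "K' / \<theta> \<le> q - \<rho>"
    using K' q by (simp add: \<theta>_def field_simps)
  then have "(1 - \<rho>) * (K' / \<theta>) \<le> q - \<rho>"
    using \<rho> K' \<theta> by (intro order_trans[OF mult_left_le_one_le]) auto
  then have contraction: "\<rho> + (1 - \<rho>) * (K' / \<theta>) \<le> q" by simp
  have "continuous_on {0..T} (\<lambda>t. \<beta>0 t \<xi> - eq_control t \<xi>)" if "\<xi> \<in> S" for \<xi>
    by (intro continuous_intros controls_continuous \<beta>0 eq_control_control that)
  then obtain B where B: "0 \<le> B" "\<And>t \<xi>. t \<in> {0..T} \<Longrightarrow> \<xi> \<in> S \<Longrightarrow> norm (\<beta>0 t \<xi> - eq_control t \<xi>) \<le> B"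
    using continuous_family_bounded[OF finite_states[of G], of 0 T "\<lambda>t \<xi>. \<beta>0 t \<xi> - eq_control t \<xi>"] by blast
  let ?\<beta> = "beta_iter G P \<Xi> \<rho> \<beta>0"
  have control: "?\<beta> n \<in> controls G" for n
    using beta_iter_control[OF \<beta>0] \<rho> by simp
  have iter: "norm (?\<beta> n t \<xi> - eq_control t \<xi>) \<le> B * q ^ n * exp (\<theta> * (T - t))"
    if "t \<in> {0..T}" "\<xi> \<in> S" for n t \<xi>
    using that
  proof (induction n arbitrary: t \<xi>)
    case 0
    have "B \<le> B * exp (\<theta> * (T - t))"
      using B(1) \<theta> 0 by (simp add: mult_le_cancel_left1)
    with B(2)[OF 0] show ?case by simp
  next
    case (Suc n)
    let ?E = "B * q ^ n * exp (\<theta> * (T - t))"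
    have "norm (best_response G P \<Xi> (?\<beta> n) t \<xi> - eq_control t \<xi>)
        \<le> C / \<gamma> * norm (diff_x (best_value G P \<Xi> (?\<beta> n) t) \<xi> - diff_x (v t) \<xi>)"
      unfolding best_response_def eq_control_def opt_rate_eq_opt_in
      by (rule opt_in_lipschitz[OF Suc.prems(2) admissible_rates])
    also have "\<dots> \<le> C / \<gamma> * (2 * real CARD('d) * (K * (B * q ^ n) / \<theta> * exp (\<theta> * (T - t))))"
      using C_nonneg gamma_pos
      by (intro mult_left_mono norm_diff_x_diff_le[OF Suc.prems(2)] stab control \<theta> Suc.prems(1) Suc.IH) auto
    also have "\<dots> = K' / \<theta> * ?E"
      by (simp add: K'_def mult_ac)
    finally have br: "norm (best_response G P \<Xi> (?\<beta> n) t \<xi> - eq_control t \<xi>) \<le> K' / \<theta> * ?E" .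
    have split: "?\<beta> (Suc n) t \<xi> - eq_control t \<xi> =
        \<rho> *\<^sub>R (?\<beta> n t \<xi> - eq_control t \<xi>) + (1 - \<rho>) *\<^sub>R (best_response G P \<Xi> (?\<beta> n) t \<xi> - eq_control t \<xi>)"
      by (simp add: algebra_simps)
    have "norm (?\<beta> (Suc n) t \<xi> - eq_control t \<xi>) \<le> \<rho> * norm (?\<beta> n t \<xi> - eq_control t \<xi>)
        + (1 - \<rho>) * norm (best_response G P \<Xi> (?\<beta> n) t \<xi> - eq_control t \<xi>)"
      unfolding split using \<rho> by (intro order_trans[OF norm_triangle_ineq]) simp
    also have "\<dots> \<le> \<rho> * ?E + (1 - \<rho>) * (K' / \<theta> * ?E)"
      using \<rho> br Suc.IH[OF Suc.prems] by (intro add_mono mult_left_mono) auto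
    also have "\<dots> = (\<rho> + (1 - \<rho>) * (K' / \<theta>)) * ?E"
      by (simp only: distrib_right mult.assoc)
    also have "\<dots> \<le> q * ?E"
      using contraction B(1) \<rho> q by (intro mult_right_mono) auto
    finally show ?case by (simp add: mult_ac)
  qed
  define A where "A = K * B / \<theta> * exp (\<theta> * T)"
  have A: "0 \<le> A" using K B \<theta> by (simp add: A_def)
  have "0 < q" using q \<rho> by simp
  \<comment> \<open>\<open>v_iter\<close> at \<open>n\<close> is the value against iterate
    \<open>n - 1\<close>, which accounts for the division by \<open>q\<close>.\<close>
  have diff: "\<bar>v_iter G P \<Xi> \<rho> \<beta>0 n t \<xi> - v t \<xi>\<bar> \<le> A / q * q ^ n"
    if n: "1 \<le> n" and t: "t \<in> {0..T}" and \<xi>: "\<xi> \<in> S" for n t \<xi>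
  proof -
    obtain m where m: "n = Suc m" using n by (cases n) auto
    have "\<bar>v_iter G P \<Xi> \<rho> \<beta>0 n t \<xi> - v t \<xi>\<bar> \<le> K * (B * q ^ m) / \<theta> * exp (\<theta> * (T - t))"
      unfolding v_iter_def m diff_Suc_1 by (intro stab control \<theta> iter t \<xi>)
    also have "\<dots> \<le> K * (B * q ^ m) / \<theta> * exp (\<theta> * T)"
      using K B \<theta> \<open>0 < q\<close> t by (intro mult_left_mono) auto
    also have "\<dots> = A / q * q ^ n"
      using \<open>0 < q\<close> by (simp add: A_def m)
    finally show ?thesis .
  qed
  \<comment> \<open>The summand 1 makes the constant strictly positive even when \<open>A\<close> is
    0.\<close>
  have "state_norm G (\<lambda>\<xi>. v_iter G P \<Xi> \<rho> \<beta>0 n t \<xi> - v t \<xi>) \<le> (real (card S) * (A / q) + 1) * q ^ n"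
    if n: "1 \<le> n" and t: "t \<in> {0..T}" for n t
  proof -
    have "state_norm G (\<lambda>\<xi>. v_iter G P \<Xi> \<rho> \<beta>0 n t \<xi> - v t \<xi>) \<le> (\<Sum>\<xi>\<in>S. \<bar>v_iter G P \<Xi> \<rho> \<beta>0 n t \<xi> - v t \<xi>\<bar>)"
      unfolding state_norm_def real_norm_def by (intro L2_set_le_sum) simp
    also have "\<dots> \<le> (\<Sum>\<xi>\<in>S. A / q * q ^ n)"
      by (intro sum_mono diff n t)
    also have "\<dots> \<le> (real (card S) * (A / q) + 1) * q ^ n"
      using \<open>0 < q\<close> by (simp add: distrib_right mult.assoc)
    finally show ?thesis .
  qed
  moreover have "0 < real (card S) * (A / q) + 1"
    using A \<open>0 < q\<close> by (simp add: add_nonneg_pos)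
  ultimately show ?thesis by blast
qed

end

theorem proposition3p3:
  fixes G :: "'d::finite game"
    and P :: "('d, 'w) laws"
    and \<Xi> :: "real \<Rightarrow> 'w \<Rightarrow> 'd state"
    and c_a :: real
    and \<beta>0 :: "'d control"
    and v :: "real \<Rightarrow> 'd state \<Rightarrow> real"
  assumes "standing_assumptions G"
    and "game_process G P \<Xi>"
    and "best_response_bound G P \<Xi> c_a"
    and "\<beta>0 \<in> bounded_controls G c_a"
    and "NLL_solution G v"
  shows "(\<exists>\<gamma> c :: real \<Rightarrow> real.
            (\<forall>\<rho>\<in>{0<..<1}. 0 < \<gamma> \<rho> \<and> \<gamma> \<rho> < 1 \<and> 0 < c \<rho> \<and>
               (\<forall>n\<ge>1. \<forall>t\<in>{0..horizon G}.
                  state_norm G (\<lambda>\<xi>. v_iter G P \<Xi> \<rho> \<beta>0 n t \<xi> - v t \<xi>) \<le> c \<rho> * \<gamma> \<rho> ^ n)) \<and>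
            mono_on {0<..<1} \<gamma> \<and> (\<gamma> \<longlongrightarrow> 0) (at_right 0)) \<and>
         (\<forall>\<eta>>0. \<exists>c>0. \<forall>n\<ge>1. \<forall>t\<in>{0..horizon G}.
            state_norm G (\<lambda>\<xi>. v_iter G P \<Xi> 0 \<beta>0 n t \<xi> - v t \<xi>) \<le> c * \<eta> ^ n)"
proof -
  obtain \<gamma> \<Lambda> where "strongly_convex_game G \<gamma> \<Lambda>"
    using standing_assumptions_imp_game[OF assms(1)] .
  then interpret mean_field_equilibrium G \<gamma> \<Lambda> P \<Xi> v
    using assms by (simp add: mean_field_equilibrium_def mean_field_game_def
        mean_field_game_axioms_def mean_field_equilibrium_axioms_def)
  have \<beta>0: "\<beta>0 \<in> controls G"
    using assms(4) by (simp add: bounded_controls_def)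
  have "\<exists>c>0. \<forall>n\<ge>1. \<forall>t\<in>{0..horizon G}.
      state_norm G (\<lambda>\<xi>. v_iter G P \<Xi> \<rho> \<beta>0 n t \<xi> - v t \<xi>) \<le> c * sqrt \<rho> ^ n" if "\<rho> \<in> {0<..<1}" for \<rho>
  proof (rule v_iter_convergence[OF \<beta>0])
    \<comment> \<open>The square root meets all demands on the rate at once: on the open unit
      interval it lies strictly between its argument and 1, it is monotone, and it vanishes at
      0.\<close>
    show "\<rho> < sqrt \<rho>"
      using that by (intro real_less_rsqrt) (simp add: power2_eq_square)
  qed (use that in auto)
  then obtain c where c: "\<forall>\<rho>\<in>{0<..<1}. 0 < c \<rho> \<and> (\<forall>n\<ge>1. \<forall>t\<in>{0..horizon G}.
      state_norm G (\<lambda>\<xi>. v_iter G P \<Xi> \<rho> \<beta>0 n t \<xi> - v t \<xi>) \<le> c \<rho> * sqrt \<rho> ^ n)"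
    by metis
  have "(sqrt \<longlongrightarrow> 0) (at_right 0)"
    using tendsto_real_sqrt[OF tendsto_ident_at[of 0 "{0<..}"]] by simp
  with c have "\<exists>\<gamma> c :: real \<Rightarrow> real.
            (\<forall>\<rho>\<in>{0<..<1}. 0 < \<gamma> \<rho> \<and> \<gamma> \<rho> < 1 \<and> 0 < c \<rho> \<and>
               (\<forall>n\<ge>1. \<forall>t\<in>{0..horizon G}.
                  state_norm G (\<lambda>\<xi>. v_iter G P \<Xi> \<rho> \<beta>0 n t \<xi> - v t \<xi>) \<le> c \<rho> * \<gamma> \<rho> ^ n)) \<and>
            mono_on {0<..<1} \<gamma> \<and> (\<gamma> \<longlongrightarrow> 0) (at_right 0)"
    by (intro exI[of _ sqrt] exI[of _ c]) (auto intro!: mono_onI)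
  moreover have "\<exists>c>0. \<forall>n\<ge>1. \<forall>t\<in>{0..horizon G}.
      state_norm G (\<lambda>\<xi>. v_iter G P \<Xi> 0 \<beta>0 n t \<xi> - v t \<xi>) \<le> c * \<eta> ^ n" if "\<eta> > 0" for \<eta>
    using v_iter_convergence[OF \<beta>0 order_refl zero_less_one that] .
  ultimately show ?thesis by blast
qed

end
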